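(* Let $t$ and $t'$ be hereditarily defined $\lambda_C$-terms and $\Gamma$ a list of distinct variables containing all their free variables. If $[\![t]\!]_\Gamma=[\![t']\!]_\Gamma$ in every $\lambda_C$-model, then $t\equiv_{\lambda_C}t'$.
   Context: The lambda calculus with constructors ($\lambda_C$). Fix a finite set of constructors $\{c_1,\dots,c_n\}$ (constants, distinct from variables). Terms: $t,u::=x\mid t\,u\mid\lambda x.t\mid c\mid\{\theta\}\cdot t$, where a case-binding $\theta=\{d_1\mapsto u_1;\dots;d_k\mapsto u_k\}$ ($k\ge0$, $d_j$ pairwise distinct constructors) has domain $\mathrm{dom}(\theta)=\{d_1,\dots,d_k\}$. Terms are up to $\alpha$-conversion. $\theta\circ\{d_1\mapsto t_1;\dots;d_k\mapsto t_k\}=\{d_1\mapsto\{\theta\}\cdot t_1;\dots;d_k\mapsto\{\theta\}\cdot t_k\}$. One-step reduction $\to$ is the contextual closure (also inside case-bindings) of: (AppLam) $(\lambda x.t)u\to t[x:=u]$; (LamApp) $\lambda x.t\,x\to t$ if $x\notin FV(t)$; (CaseCons) $\{\theta\}\cdot c\to t$ if $(c\mapsto t)\in\theta$; (CaseApp) $\{\theta\}\cdot(tu)\to(\{\theta\}\cdot t)u$; (CaseLam) $\{\theta\}\cdot\lambda x.t\to\lambda x.\{\theta\}\cdot t$ if $x\notin FV(\theta)$; (CaseCase) $\{\theta\}\cdot\{\phi\}\cdot t\to\{\theta\circ\phi\}\cdot t$. $\equiv_{\lambda_C}$ is the reflexive symmetric transitive closure of $\to$. A match failure is a term $\{\theta\}\cdot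 c$ with $c\notin\mathrm{dom}(\theta)$; a term is defined if none of its subterms is a match failure, and hereditarily defined if all its reducts (in zero or more steps) are defined. Categorical notation: composition in diagrammatic order $f;g$; $\langle f,g\rangle$ pairing; $\pi^k_i$ projections ($\pi_i=\pi^2_i$); $!_A:A\to1$; $D^k$ $k$-fold product; $B^A$ exponential, $\mathrm{ev}$ evaluation, $\Lambda$ currying; $\alpha$ canonical associativity isomorphisms $(A\times B)\times C\to A\times(B\times C)$. A $\lambda_C$-model is $(\mathcal C,D,\mathtt{app},\mathtt{lam},(\bar c_i)_{i=1}^n,\mathtt{fail},\mathtt{case})$ with $\mathcal C$ cartesian closed, $\bar c_i,\mathtt{fail}:1\to D$, $\mathtt{app}:D\to D^D$, $\mathtt{lam}:D^D\to D$, $\mathtt{case}:D^n\times D\to D$ such that, with $\widehat{\mathtt{case}}=\Lambda(\alpha;(\mathrm{id}_{D^n}\times\mathrm{ev});\mathtt{case})$ and $\mathtt{comp}=\langle(\mathrm{id}_{D^n}\times\pi^n_1);\mathtt{case},\dots,(\mathrm{id}_{D^n}\times\pi^n_n);\mathtt{case}\rangle:D^n\times D^n\to D^n$: (D1) $\mathtt{lam};\mathtt{app}=\mathrm{id}_{D^D}$, $\mathtt{app};\mathtt{lam}=\mathrm{id}_D$; (D2) for all $i$, $\langle\mathrm{id}_{D^n},!_{D^n}\rangle;(\mathrm{id}_{D^n}\times\bar c_i);\mathtt{case}=\pi^n_i$; (D3) $(\mathtt{case}\times\mathrm{id}_D);(\mathtt{app}\times\mathrm{id}_D);\mathrm{ev}=\alpha;(\mathrm{id}_{D^n}\times(\mathtt{app}\times\mathrm{id}_D));(\mathrm{id}_{D^n}\times\mathrm{ev});\mathtt{case}$;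 (D4) $\widehat{\mathtt{case}};\mathtt{lam}=(\mathrm{id}_{D^n}\times\mathtt{lam});\mathtt{case}$; (D5) $(\mathtt{comp}\times\mathrm{id}_D);\mathtt{case}=\alpha;(\mathrm{id}_{D^n}\times\mathtt{case});\mathtt{case}$; (D6) $(\mathrm{id}_{D^n}\times\mathtt{fail});\mathtt{case}=\pi_2;\mathtt{fail}$ as maps $D^n\times1\to D$. Interpretation for $\Gamma=x_1,\dots,x_k$: $[\![x_i]\!]_\Gamma=\pi^k_i$; $[\![tu]\!]_\Gamma=\langle[\![t]\!]_\Gamma,[\![u]\!]_\Gamma\rangle;(\mathtt{app}\times\mathrm{id}_D);\mathrm{ev}$; $[\![\lambda x_{k+1}.t]\!]_\Gamma=\Lambda(f_t);\mathtt{lam}$ with $x_{k+1}\notin\Gamma$ and $f_t$ the iso $D^k\times D\cong D^{k+1}$ followed by $[\![t]\!]_{\Gamma,x_{k+1}}$; $[\![c_i]\!]_\Gamma=!_{D^k};\bar c_i$; $[\![\{\theta\}\cdot t]\!]_\Gamma=\langle[\![\theta]\!]_\Gamma,[\![t]\!]_\Gamma\rangle;\mathtt{case}$; $[\![\theta]\!]_\Gamma=\langle f_1,\dots,f_n\rangle$, $f_i=[\![u_i]\!]_\Gamma$ if $(c_i\mapsto u_i)\in\theta$, else $f_i=!_{D^k};\mathtt{fail}$. *)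

theory Defs
  imports Main "HOL-Library.Finite_Map"
begin

section \<open>The lambda calculus with constructors\<close>

text \<open>
  Terms modulo alpha-conversion are represented with de Bruijn indices: \<open>Var i\<close> below \<open>k\<close>
  binders is bound if \<open>i < k\<close> and is the free variable \<open>i - k\<close> otherwise. The constructors
  \<open>c\<^sub>1, \<dots>, c\<^sub>n\<close> are \<open>Con 0, \<dots>, Con (n - 1)\<close>. A case-binding is a finite map from
  constructors to terms; \<open>Case \<theta> t\<close> stands for \<open>{\<theta>} \<cdot> t\<close>.
\<close>

datatype trm =
    Var nat
  | App trm trm
  | Lam trm
  | Con nat
  | Case "(nat, trm) fmap" trm

text \<open>The terms over the set of constructors \<open>{c\<^sub>1, \<dots>, c\<^sub>n}\<close>.\<close>

inductive is_term :: "nat \<Rightarrow> trm \<Rightarrow> bool" for n where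
  "is_term n (Var i)"
| "is_term n t \<Longrightarrow> is_term n u \<Longrightarrow> is_term n (App t u)"
| "is_term n t \<Longrightarrow> is_term n (Lam t)"
| "c < n \<Longrightarrow> is_term n (Con c)"
| "(\<And>c u. fmlookup \<theta> c = Some u \<Longrightarrow> c < n \<and> is_term n u) \<Longrightarrow> is_term n t
    \<Longrightarrow> is_term n (Case \<theta> t)"

primrec fv :: "trm \<Rightarrow> nat set" where
  "fv (Var i) = {i}"
| "fv (App t u) = fv t \<union> fv u"
| "fv (Lam t) = {i. Suc i \<in> fv t}"
| "fv (Con c) = {}"
| "fv (Case \<theta> t) = \<Union> (fmran' (fmmap fv \<theta>)) \<union> fv t"

primrec rename :: "trm \<Rightarrow> (nat \<Rightarrow> nat) \<Rightarrow> trm" where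
  "rename (Var i) r = Var (r i)"
| "rename (App t u) r = App (rename t r) (rename u r)"
| "rename (Lam t) r = Lam (rename t (case_nat 0 (Suc \<circ> r)))"
| "rename (Con c) r = Con c"
| "rename (Case \<theta> t) r = Case (fmmap (\<lambda>u. rename u r) \<theta>) (rename t r)"

text \<open>\<open>lift t\<close> is \<open>t\<close> placed under one more binder, whose variable does not occur in it.\<close>

abbreviation lift :: "trm \<Rightarrow> trm" where
  "lift t \<equiv> rename t Suc"

primrec subst :: "trm \<Rightarrow> (nat \<Rightarrow> trm) \<Rightarrow> trm" where
  "subst (Var i) s = s i"
| "subst (App t u) s = App (subst t s) (subst u s)"
| "subst (Lam t) s = Lam (subst t (case_nat (Var 0) (\<lambda>i. lift (s i))))"
| "subst (Con c) s = Con c"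
| "subst (Case \<theta> t) s = Case (fmmap (\<lambda>u. subst u s) \<theta>) (subst t s)"

text \<open>\<open>inst t u\<close> is \<open>t[x := u]\<close> for the body \<open>t\<close> of an abstraction over \<open>x\<close>.\<close>

definition inst :: "trm \<Rightarrow> trm \<Rightarrow> trm" where
  "inst t u = subst t (case_nat u Var)"

definition case_comp :: "(nat, trm) fmap \<Rightarrow> (nat, trm) fmap \<Rightarrow> (nat, trm) fmap" where
  "case_comp \<theta> \<phi> = fmmap (\<lambda>t. Case \<theta> t) \<phi>"

text \<open>
  The side conditions \<open>x \<notin> FV(t)\<close> of LamApp and \<open>x \<notin> FV(\<theta>)\<close> of CaseLam are expressed by
  \<open>lift\<close>: the terms not containing index 0 are exactly those of the form \<open>lift t\<close>.
\<close>

inductive step :: "trm \<Rightarrow> trm \<Rightarrow> bool" where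
  AppLam: "step (App (Lam t) u) (inst t u)"
| LamApp: "step (Lam (App (lift t) (Var 0))) t"
| CaseCons: "fmlookup \<theta> c = Some t \<Longrightarrow> step (Case \<theta> (Con c)) t"
| CaseApp: "step (Case \<theta> (App t u)) (App (Case \<theta> t) u)"
| CaseLam: "step (Case \<theta> (Lam t)) (Lam (Case (fmmap lift \<theta>) t))"
| CaseCase: "step (Case \<theta> (Case \<phi> t)) (Case (case_comp \<theta> \<phi>) t)"
| AppL: "step t t' \<Longrightarrow> step (App t u) (App t' u)"
| AppR: "step u u' \<Longrightarrow> step (App t u) (App t u')"
| LamBody: "step t t' \<Longrightarrow> step (Lam t) (Lam t')"
| CaseArg: "step t t' \<Longrightarrow> step (Case \<theta> t) (Case \<theta> t')"
| CaseBranch: "fmlookup \<theta> c = Some u \<Longrightarrow> step u u' \<Longrightarrow> step (Case \<theta> t) (Case (fmupd c u' \<theta>) t)"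

text \<open>
  Conversion between terms over \<open>c\<^sub>1, \<dots>, c\<^sub>n\<close>: every intermediate term, including those
  obtained by expansion, is built from these constructors only.
\<close>

definition conv :: "nat \<Rightarrow> trm \<Rightarrow> trm \<Rightarrow> bool" where
  "conv n = equivclp (\<lambda>t u. is_term n t \<and> is_term n u \<and> step t u)"

inductive subterm :: "trm \<Rightarrow> trm \<Rightarrow> bool" where
  "subterm t t"
| "subterm s t \<Longrightarrow> subterm s (App t u)"
| "subterm s u \<Longrightarrow> subterm s (App t u)"
| "subterm s t \<Longrightarrow> subterm s (Lam t)"
| "subterm s t \<Longrightarrow> subterm s (Case \<theta> t)"
| "fmlookup \<theta> c = Some u \<Longrightarrow> subterm s u \<Longrightarrow> subterm s (Case \<theta> t)"

definition match_failure :: "trm \<Rightarrow> bool" where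
  "match_failure t \<longleftrightarrow> (\<exists>\<theta> c. t = Case \<theta> (Con c) \<and> c |\<notin>| fmdom \<theta>)"

definition defined :: "trm \<Rightarrow> bool" where
  "defined t \<longleftrightarrow> (\<forall>s. subterm s t \<longrightarrow> \<not> match_failure s)"

definition hereditarily_defined :: "trm \<Rightarrow> bool" where
  "hereditarily_defined t \<longleftrightarrow> (\<forall>u. step\<^sup>*\<^sup>* t u \<longrightarrow> defined u)"


section \<open>Cartesian closed categories\<close>

text \<open>
  Small categories with objects in \<open>'o\<close> and arrows in \<open>'m\<close>, equipped with a chosen cartesian
  closed structure; \<open>f \<Zsemi> g\<close> is composition in diagrammatic order. \<open>Exp A B\<close> is the exponential
  \<open>B\<^sup>A\<close>. \<open>Curry A B f : A \<rightarrow> C\<^sup>B\<close> is \<open>\<Lambda>(f)\<close> for \<open>f : A \<times> B \<rightarrow> C\<close>; the objects \<open>A\<close> and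
  \<open>B\<close> are arguments because they need not be determined by \<open>A \<times> B\<close>.
\<close>

record ('o, 'm) ccc =
  Obj :: "'o set"
  Arr :: "'m set"
  Dom :: "'m \<Rightarrow> 'o"
  Cod :: "'m \<Rightarrow> 'o"
  Id :: "'o \<Rightarrow> 'm"
  Comp :: "'m \<Rightarrow> 'm \<Rightarrow> 'm" (infixl "\<Zsemi>\<index>" 60)
  One :: "'o"
  Bang :: "'o \<Rightarrow> 'm"
  Prod :: "'o \<Rightarrow> 'o \<Rightarrow> 'o" (infixr "\<otimes>\<index>" 70)
  P1 :: "'o \<Rightarrow> 'o \<Rightarrow> 'm"
  P2 :: "'o \<Rightarrow> 'o \<Rightarrow> 'm"
  Pairing :: "'m \<Rightarrow> 'm \<Rightarrow> 'm" ("\<langle>_,/ _\<rangle>\<index>")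
  Exp :: "'o \<Rightarrow> 'o \<Rightarrow> 'o"
  Ev :: "'o \<Rightarrow> 'o \<Rightarrow> 'm"
  Curry :: "'o \<Rightarrow> 'o \<Rightarrow> 'm \<Rightarrow> 'm"

definition Hom :: "('o, 'm, 'x) ccc_scheme \<Rightarrow> 'o \<Rightarrow> 'o \<Rightarrow> 'm set" where
  "Hom C A B = {f \<in> Arr C. Dom C f = A \<and> Cod C f = B}"

definition Times :: "('o, 'm, 'x) ccc_scheme \<Rightarrow> 'm \<Rightarrow> 'm \<Rightarrow> 'm" (infixr "\<otimes>\<^sub>m\<index>" 70) where
  "Times C f g = (let A = Dom C f; B = Dom C g in \<langle>P1 C A B \<Zsemi>\<^bsub>C\<^esub> f, P2 C A B \<Zsemi>\<^bsub>C\<^esub> g\<rangle>\<^bsub>C\<^esub>)"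

text \<open>\<open>Assoc X Y Z : (X \<times> Y) \<times> Z \<rightarrow> X \<times> (Y \<times> Z)\<close>.\<close>

definition Assoc :: "('o, 'm, 'x) ccc_scheme \<Rightarrow> 'o \<Rightarrow> 'o \<Rightarrow> 'o \<Rightarrow> 'm" where
  "Assoc C X Y Z =
    \<langle>P1 C (X \<otimes>\<^bsub>C\<^esub> Y) Z \<Zsemi>\<^bsub>C\<^esub> P1 C X Y,
     \<langle>P1 C (X \<otimes>\<^bsub>C\<^esub> Y) Z \<Zsemi>\<^bsub>C\<^esub> P2 C X Y, P2 C (X \<otimes>\<^bsub>C\<^esub> Y) Z\<rangle>\<^bsub>C\<^esub>\<rangle>\<^bsub>C\<^esub>"

text \<open>
  The power \<open>D\<^sup>k\<close> is the left-nested product \<open>((1 \<times> D) \<times> \<dots>) \<times> D\<close>, so that the isomorphism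
  \<open>D\<^sup>k \<times> D \<cong> D\<^sup>k\<^sup>+\<^sup>1\<close> is the identity. Projections and tuples are indexed from 0:
  \<open>Proj C D k i\<close> is the projection \<open>D\<^sup>k \<rightarrow> D\<close> onto the component \<open>i + 1\<close>, for \<open>i < k\<close>, and
  \<open>Tuple C X f k\<close> is \<open>\<langle>f 0, \<dots>, f (k - 1)\<rangle> : X \<rightarrow> D\<^sup>k\<close>.
\<close>

primrec Power :: "('o, 'm, 'x) ccc_scheme \<Rightarrow> 'o \<Rightarrow> nat \<Rightarrow> 'o" where
  "Power C D 0 = One C"
| "Power C D (Suc k) = Power C D k \<otimes>\<^bsub>C\<^esub> D"

primrec Proj :: "('o, 'm, 'x) ccc_scheme \<Rightarrow> 'o \<Rightarrow> nat \<Rightarrow> nat \<Rightarrow> 'm" where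
  "Proj C D 0 i = undefined"
| "Proj C D (Suc k) i =
    (if i = k then P2 C (Power C D k) D else P1 C (Power C D k) D \<Zsemi>\<^bsub>C\<^esub> Proj C D k i)"

primrec Tuple :: "('o, 'm, 'x) ccc_scheme \<Rightarrow> 'o \<Rightarrow> (nat \<Rightarrow> 'm) \<Rightarrow> nat \<Rightarrow> 'm" where
  "Tuple C X f 0 = Bang C X"
| "Tuple C X f (Suc k) = \<langle>Tuple C X f k, f k\<rangle>\<^bsub>C\<^esub>"

locale ccc =
  fixes C :: "('o, 'm, 'x) ccc_scheme" (structure)
  assumes Dom_Obj: "f \<in> Arr C \<Longrightarrow> Dom C f \<in> Obj C"
    and Cod_Obj: "f \<in> Arr C \<Longrightarrow> Cod C f \<in> Obj C"
    and Id_Hom: "A \<in> Obj C \<Longrightarrow> Id C A \<in> Hom C A A"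
    and Comp_Hom: "f \<in> Hom C X Y \<Longrightarrow> g \<in> Hom C Y Z \<Longrightarrow> f \<Zsemi> g \<in> Hom C X Z"
    and Id_left: "f \<in> Hom C X Y \<Longrightarrow> Id C X \<Zsemi> f = f"
    and Id_right: "f \<in> Hom C X Y \<Longrightarrow> f \<Zsemi> Id C Y = f"
    and Comp_assoc: "f \<in> Hom C X Y \<Longrightarrow> g \<in> Hom C Y Z \<Longrightarrow> h \<in> Hom C Z W
      \<Longrightarrow> (f \<Zsemi> g) \<Zsemi> h = f \<Zsemi> (g \<Zsemi> h)"
    and One_Obj: "One C \<in> Obj C"
    and Bang_Hom: "X \<in> Obj C \<Longrightarrow> Bang C X \<in> Hom C X (One C)"
    and Bang_unique: "f \<in> Hom C X (One C) \<Longrightarrow> f = Bang C X"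
    and Prod_Obj: "A \<in> Obj C \<Longrightarrow> B \<in> Obj C \<Longrightarrow> A \<otimes> B \<in> Obj C"
    and P1_Hom: "A \<in> Obj C \<Longrightarrow> B \<in> Obj C \<Longrightarrow> P1 C A B \<in> Hom C (A \<otimes> B) A"
    and P2_Hom: "A \<in> Obj C \<Longrightarrow> B \<in> Obj C \<Longrightarrow> P2 C A B \<in> Hom C (A \<otimes> B) B"
    and Pairing_Hom: "f \<in> Hom C X A \<Longrightarrow> g \<in> Hom C X B \<Longrightarrow> \<langle>f, g\<rangle> \<in> Hom C X (A \<otimes> B)"
    and Pairing_P1: "f \<in> Hom C X A \<Longrightarrow> g \<in> Hom C X B \<Longrightarrow> \<langle>f, g\<rangle> \<Zsemi> P1 C A B = f"
    and Pairing_P2: "f \<in> Hom C X A \<Longrightarrow> g \<in> Hom C X B \<Longrightarrow> \<langle>f, g\<rangle> \<Zsemi> P2 C A B = g"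
    and Pairing_unique: "A \<in> Obj C \<Longrightarrow> B \<in> Obj C \<Longrightarrow> h \<in> Hom C X (A \<otimes> B)
      \<Longrightarrow> h = \<langle>h \<Zsemi> P1 C A B, h \<Zsemi> P2 C A B\<rangle>"
    and Exp_Obj: "A \<in> Obj C \<Longrightarrow> B \<in> Obj C \<Longrightarrow> Exp C A B \<in> Obj C"
    and Ev_Hom: "A \<in> Obj C \<Longrightarrow> B \<in> Obj C \<Longrightarrow> Ev C A B \<in> Hom C (Exp C A B \<otimes> A) B"
    and Curry_Hom: "X \<in> Obj C \<Longrightarrow> A \<in> Obj C \<Longrightarrow> f \<in> Hom C (X \<otimes> A) B
      \<Longrightarrow> Curry C X A f \<in> Hom C X (Exp C A B)"
    and Curry_Ev: "X \<in> Obj C \<Longrightarrow> A \<in> Obj C \<Longrightarrow> f \<in> Hom C (X \<otimes> A) B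
      \<Longrightarrow> (Curry C X A f \<otimes>\<^sub>m Id C A) \<Zsemi> Ev C A B = f"
    and Curry_unique: "A \<in> Obj C \<Longrightarrow> B \<in> Obj C \<Longrightarrow> g \<in> Hom C X (Exp C A B)
      \<Longrightarrow> g = Curry C X A ((g \<otimes>\<^sub>m Id C A) \<Zsemi> Ev C A B)"


section \<open>Models\<close>

text \<open>
  The constructor \<open>Con i\<close> is interpreted by \<open>con i\<close>, for \<open>i < n\<close>; the arrow \<open>cas\<close> interprets
  the case construct.
\<close>

record ('o, 'm) lc_model = "('o, 'm) ccc" +
  D :: "'o"
  app :: "'m"
  lam :: "'m"
  con :: "nat \<Rightarrow> 'm"
  fail :: "'m"
  cas :: "'m"

text \<open>The arrow \<open>\<Lambda>(\<alpha>; (id \<times> ev); case) : D\<^sup>n \<times> D\<^sup>D \<rightarrow> D\<^sup>D\<close>.\<close>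

definition cas_hat :: "nat \<Rightarrow> ('o, 'm, 'x) lc_model_scheme \<Rightarrow> 'm" where
  "cas_hat n M =
    (let Dn = Power M (D M) n; DD = Exp M (D M) (D M) in
      Curry M (Dn \<otimes>\<^bsub>M\<^esub> DD) (D M)
        (Assoc M Dn DD (D M) \<Zsemi>\<^bsub>M\<^esub> (Id M Dn \<otimes>\<^sub>m\<^bsub>M\<^esub> Ev M (D M) (D M)) \<Zsemi>\<^bsub>M\<^esub> cas M))"

text \<open>The arrow \<open>comp : D\<^sup>n \<times> D\<^sup>n \<rightarrow> D\<^sup>n\<close>.\<close>

definition cas_comp :: "nat \<Rightarrow> ('o, 'm, 'x) lc_model_scheme \<Rightarrow> 'm" where
  "cas_comp n M =
    (let Dn = Power M (D M) n in
      Tuple M (Dn \<otimes>\<^bsub>M\<^esub> Dn) (\<lambda>i. (Id M Dn \<otimes>\<^sub>m\<^bsub>M\<^esub> Proj M (D M) n i) \<Zsemi>\<^bsub>M\<^esub> cas M) n)"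

locale lc_model = ccc M for n :: nat and M :: "('o, 'm, 'x) lc_model_scheme" (structure) +
  fixes Dn :: 'o and DD :: 'o and idn :: 'm and idD :: 'm and ev :: 'm
  defines "Dn \<equiv> Power M (D M) n"
    and "DD \<equiv> Exp M (D M) (D M)"
    and "idn \<equiv> Id M Dn"
    and "idD \<equiv> Id M (D M)"
    and "ev \<equiv> Ev M (D M) (D M)"
  assumes D_Obj: "D M \<in> Obj M"
    and app_Hom: "app M \<in> Hom M (D M) DD"
    and lam_Hom: "lam M \<in> Hom M DD (D M)"
    and con_Hom: "i < n \<Longrightarrow> con M i \<in> Hom M (One M) (D M)"
    and fail_Hom: "fail M \<in> Hom M (One M) (D M)"
    and cas_Hom: "cas M \<in> Hom M (Dn \<otimes> D M) (D M)"
    and D1_lam_app: "lam M \<Zsemi> app M = Id M DD"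
    and D1_app_lam: "app M \<Zsemi> lam M = idD"
    and D2: "i < n \<Longrightarrow> \<langle>idn, Bang M Dn\<rangle> \<Zsemi> (idn \<otimes>\<^sub>m con M i) \<Zsemi> cas M = Proj M (D M) n i"
    and D3: "(cas M \<otimes>\<^sub>m idD) \<Zsemi> (app M \<otimes>\<^sub>m idD) \<Zsemi> ev =
      Assoc M Dn (D M) (D M) \<Zsemi> (idn \<otimes>\<^sub>m (app M \<otimes>\<^sub>m idD)) \<Zsemi> (idn \<otimes>\<^sub>m ev) \<Zsemi> cas M"
    and D4: "cas_hat n M \<Zsemi> lam M = (idn \<otimes>\<^sub>m lam M) \<Zsemi> cas M"
    and D5: "(cas_comp n M \<otimes>\<^sub>m idD) \<Zsemi> cas M = Assoc M Dn Dn (D M) \<Zsemi> (idn \<otimes>\<^sub>m cas M) \<Zsemi> cas M"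
    and D6: "(idn \<otimes>\<^sub>m fail M) \<Zsemi> cas M = P2 M Dn (One M) \<Zsemi> fail M"

text \<open>
  \<open>interp n M t \<Gamma>\<close> is the interpretation of \<open>t\<close> in the context \<open>\<Gamma>\<close>, a list of distinct de Bruijn
  indices. Under an abstraction the indices in \<open>\<Gamma>\<close> are shifted and the bound variable, of
  index 0, is added at the end.
\<close>

definition position :: "nat list \<Rightarrow> nat \<Rightarrow> nat" where
  "position \<Gamma> x = (THE j. j < length \<Gamma> \<and> \<Gamma> ! j = x)"

primrec interp :: "nat \<Rightarrow> ('o, 'm, 'x) lc_model_scheme \<Rightarrow> trm \<Rightarrow> nat list \<Rightarrow> 'm" where
  "interp n M (Var x) \<Gamma> = Proj M (D M) (length \<Gamma>) (position \<Gamma> x)"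
| "interp n M (App t u) \<Gamma> =
    \<langle>interp n M t \<Gamma>, interp n M u \<Gamma>\<rangle>\<^bsub>M\<^esub> \<Zsemi>\<^bsub>M\<^esub> (app M \<otimes>\<^sub>m\<^bsub>M\<^esub> Id M (D M)) \<Zsemi>\<^bsub>M\<^esub> Ev M (D M) (D M)"
| "interp n M (Lam t) \<Gamma> =
    Curry M (Power M (D M) (length \<Gamma>)) (D M) (interp n M t (map Suc \<Gamma> @ [0])) \<Zsemi>\<^bsub>M\<^esub> lam M"
| "interp n M (Con c) \<Gamma> = Bang M (Power M (D M) (length \<Gamma>)) \<Zsemi>\<^bsub>M\<^esub> con M c"
| "interp n M (Case \<theta> t) \<Gamma> =
    \<langle>Tuple M (Power M (D M) (length \<Gamma>))
        (\<lambda>i. case fmlookup (fmmap (\<lambda>u. interp n M u \<Gamma>) \<theta>) i of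
           Some f \<Rightarrow> f
         | None \<Rightarrow> Bang M (Power M (D M) (length \<Gamma>)) \<Zsemi>\<^bsub>M\<^esub> fail M) n,
     interp n M t \<Gamma>\<rangle>\<^bsub>M\<^esub> \<Zsemi>\<^bsub>M\<^esub> cas M"

end

theory Submission
  imports Defs "HOL-Library.Confluence" "HOL-Library.Countable"
begin

text \<open>
  The commutation rules for the case construct are turned into a computation: completing every
  case-binding with a constant for failure, which absorbs cases, and pushing cases inwards as far
  as possible, a term becomes a normal form in which a case is only applied to a variable. On these
  normal forms substitution pushes cases again, the axioms D2--D6 hold as equations or by eta, and
  beta-eta reduction is confluent because its parallel version has the diamond property.

  Since \<open>D\<close> and \<open>D\<^sup>D\<close> are isomorphic, the category with objects the natural numbers and
  arrows \<open>k \<rightarrow> m\<close> the \<open>m\<close>-tuples of normal forms in \<open>k\<close> variables modulo conversion is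
  cartesian closed, and it is a model in which two terms are equal iff their normal forms are
  convertible. The common reduct \<open>v\<close> of the normal forms of two hereditarily defined terms contains
  failure only as a missing branch, because a missing branch is never selected. So deleting the
  failing branches from \<open>v\<close> gives a common reduct of the two terms themselves.
\<close>

section \<open>Case-normal forms\<close>

text \<open>A binding is meant as a list of length \<open>n\<close> whose entry \<open>c\<close>
  belongs to constructor \<open>c\<close>, a missing branch being an explicit \<open>NFail\<close>.
  Composing bindings is then a map over the list, and failure is propagated by equations.\<close>

datatype nform =
    NVar nat
  | NCon nat
  | NFail
  | NApp nform nform
  | NLam nform
  | NCase "nform list" nat

text \<open>Used to code the arrows of the term model in an arbitrary infinite type.\<close>

instance nform :: countable
  by countable_datatype

primrec nfv :: "nform \<Rightarrow> nat set" where
  "nfv (NVar i) = {i}"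
| "nfv (NCon c) = {}"
| "nfv NFail = {}"
| "nfv (NApp t u) = nfv t \<union> nfv u"
| "nfv (NLam t) = {i. Suc i \<in> nfv t}"
| "nfv (NCase \<phi> x) = insert x (\<Union> (set (map nfv \<phi>)))"

primrec nrename :: "nform \<Rightarrow> (nat \<Rightarrow> nat) \<Rightarrow> nform" where
  "nrename (NVar i) r = NVar (r i)"
| "nrename (NCon c) r = NCon c"
| "nrename NFail r = NFail"
| "nrename (NApp t u) r = NApp (nrename t r) (nrename u r)"
| "nrename (NLam t) r = NLam (nrename t (case_nat 0 (Suc \<circ> r)))"
| "nrename (NCase \<phi> x) r = NCase (map (\<lambda>u. nrename u r) \<phi>) (r x)"

abbreviation nlift :: "nform \<Rightarrow> nform" where
  "nlift t \<equiv> nrename t Suc"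

text \<open>The rules CaseCons, CaseApp, CaseLam and CaseCase as a function, a case on a variable
  being stuck. The clause for \<open>NFail\<close> mirrors axiom D6.\<close>

primrec push :: "nform \<Rightarrow> nform list \<Rightarrow> nform" where
  "push (NVar i) \<theta> = NCase \<theta> i"
| "push (NCon c) \<theta> = (if c < length \<theta> then \<theta> ! c else NFail)"
| "push NFail \<theta> = NFail"
| "push (NApp t u) \<theta> = NApp (push t \<theta>) u"
| "push (NLam t) \<theta> = NLam (push t (map nlift \<theta>))"
| "push (NCase \<phi> x) \<theta> = NCase (map (\<lambda>u. push u \<theta>) \<phi>) x"

text \<open>A case on \<open>x\<close> may become unstuck when \<open>s x\<close> is substituted, so
  it is pushed again. Beta-redexes that arise are left alone, which keeps the recursion
  structural.\<close>

primrec nsubst :: "nform \<Rightarrow> (nat \<Rightarrow> nform) \<Rightarrow> nform" where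
  "nsubst (NVar i) s = s i"
| "nsubst (NCon c) s = NCon c"
| "nsubst NFail s = NFail"
| "nsubst (NApp t u) s = NApp (nsubst t s) (nsubst u s)"
| "nsubst (NLam t) s = NLam (nsubst t (case_nat (NVar 0) (\<lambda>i. nlift (s i))))"
| "nsubst (NCase \<phi> x) s = push (s x) (map (\<lambda>u. nsubst u s) \<phi>)"

section \<open>Algebra of renaming, pushing and substitution\<close>

lemma nrename_cong: "(\<And>i. i \<in> nfv t \<Longrightarrow> r i = r' i) \<Longrightarrow> nrename t r = nrename t r'"
proof (induction t arbitrary: r r')
  case (NApp t u)
  from NApp.IH(1)[of r r'] NApp.IH(2)[of r r'] NApp.prems show ?case by simp
next
  case (NLam t)
  have "nrename t (case_nat 0 (Suc \<circ> r)) = nrename t (case_nat 0 (Suc \<circ> r'))"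
    by (rule NLam.IH) (use NLam.prems in \<open>auto split: nat.split\<close>)
  then show ?case by simp
next
  case (NCase \<phi> x)
  have "nrename u r = nrename u r'" if "u \<in> set \<phi>" for u
    by (rule NCase.IH[OF that], rule NCase.prems) (use that in auto)
  with NCase.prems show ?case by simp
qed simp_all

lemma nrename_ident: "(\<And>i. i \<in> nfv t \<Longrightarrow> r i = i) \<Longrightarrow> nrename t r = t"
proof (induction t arbitrary: r)
  case (NApp t u)
  from NApp.IH(1)[of r] NApp.IH(2)[of r] NApp.prems show ?case by simp
next
  case (NLam t)
  have "nrename t (case_nat 0 (Suc \<circ> r)) = t"
    by (rule NLam.IH) (use NLam.prems in \<open>auto split: nat.split\<close>)
  then show ?case by simp
next
  case (NCase \<phi> x)
  have "nrename u r = u" if "u \<in> set \<phi>" for u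
    by (rule NCase.IH[OF that], rule NCase.prems) (use that in auto)
  with NCase.prems show ?case by (simp add: map_idI)
qed simp_all

lemma nrename_nrename: "nrename (nrename t r) r' = nrename t (r' \<circ> r)"
proof (induction t arbitrary: r r')
  case (NLam t)
  show ?case by (simp add: NLam.IH) (rule nrename_cong, simp split: nat.split)
qed simp_all

lemma nlift_nrename: "nlift (nrename t r) = nrename (nlift t) (case_nat 0 (Suc \<circ> r))"
  unfolding nrename_nrename by (rule nrename_cong) simp

lemma nrename_push: "nrename (push t \<theta>) r = push (nrename t r) (map (\<lambda>u. nrename u r) \<theta>)"
proof (induction t arbitrary: \<theta> r)
  case (NLam t)
  then show ?case by (simp add: comp_def flip: nlift_nrename[unfolded comp_def])
qed auto

text \<open>CaseCase for an arbitrary argument. Commuting \<open>nsubst\<close> with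
  \<open>push\<close> rests on it, as substituting into a stuck case pushes a second time.\<close>

lemma push_push: "push (push t \<phi>) \<theta> = push t (map (\<lambda>u. push u \<theta>) \<phi>)"
  by (induction t arbitrary: \<phi> \<theta>) (auto simp: comp_def nrename_push)

lemma nsubst_nrename: "nsubst (nrename t r) s = nsubst t (s \<circ> r)"
proof (induction t arbitrary: r s)
  case (NLam t)
  show ?case
    by (simp add: NLam.IH) (rule arg_cong[where f = "nsubst t"], auto split: nat.split)
qed (auto simp: comp_def cong: map_cong)

lemma nrename_nsubst: "nrename (nsubst t s) r = nsubst t (\<lambda>i. nrename (s i) r)"
proof (induction t arbitrary: r s)
  case (NLam t)
  show ?case
    by (simp add: NLam.IH)
      (rule arg_cong[where f = "nsubst t"], auto simp: nlift_nrename split: nat.split)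
qed (auto simp: comp_def nrename_push cong: map_cong)

lemma nlift_nsubst:
  "nlift (nsubst t s) = nsubst (nlift t) (case_nat (NVar 0) (\<lambda>i. nlift (s i)))"
  by (simp add: nrename_nsubst nsubst_nrename comp_def)

lemma nsubst_push: "nsubst (push t \<theta>) s = push (nsubst t s) (map (\<lambda>u. nsubst u s) \<theta>)"
proof (induction t arbitrary: \<theta> s)
  case (NLam t)
  then show ?case by (simp add: comp_def nlift_nsubst)
qed (auto simp: push_push comp_def cong: map_cong)

lemma nsubst_nsubst: "nsubst (nsubst t s) s' = nsubst t (\<lambda>i. nsubst (s i) s')"
proof (induction t arbitrary: s s')
  case (NLam t)
  show ?case
    by (simp add: NLam.IH)
      (rule arg_cong[where f = "nsubst t"], auto simp: nlift_nsubst split: nat.split)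
qed (auto simp: comp_def nsubst_push cong: map_cong)

lemma nsubst_NVar_comp: "nsubst t (\<lambda>i. NVar (r i)) = nrename t r"
proof (induction t arbitrary: r)
  case (NLam t)
  have "case_nat (NVar 0) (\<lambda>i. nlift (NVar (r i))) = (\<lambda>i. NVar (case_nat 0 (Suc \<circ> r) i))"
    by (auto split: nat.split)
  then show ?case by (simp add: NLam.IH)
qed auto

lemma nsubst_NVar [simp]: "nsubst t NVar = t"
  using nsubst_NVar_comp[of t "\<lambda>i. i"] by (simp add: nrename_ident)

lemma nfv_nrename: "nfv (nrename t r) = r ` nfv t"
proof (induction t arbitrary: r)
  case (NLam t)
  show ?case by (auto simp: NLam.IH image_iff split: nat.splits) (metis gr0_implies_Suc)
qed auto

lemma nfv_push: "nfv (push t \<theta>) \<subseteq> nfv t \<union> \<Union> (nfv ` set \<theta>)"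
proof (induction t arbitrary: \<theta>)
  case (NLam t)
  show ?case using NLam.IH[of "map nlift \<theta>"] by (auto simp: nfv_nrename)
next
  case (NCase \<phi> x)
  then show ?case by fastforce
qed (auto dest: nth_mem)

lemma nfv_nsubst: "nfv (nsubst t s) \<subseteq> (\<Union>i\<in>nfv t. nfv (s i))"
proof (induction t arbitrary: s)
  case (NLam t)
  show ?case
  proof
    fix i assume "i \<in> nfv (nsubst (NLam t) s)"
    then obtain j where "j \<in> nfv t" "Suc i \<in> nfv (case_nat (NVar 0) (\<lambda>i. nlift (s i)) j)"
      using NLam.IH by auto
    then show "i \<in> (\<Union>i\<in>nfv (NLam t). nfv (s i))"
      by (cases j) (auto simp: nfv_nrename)
  qed
next
  case (NApp t u)
  show ?case using NApp.IH(1)[of s] NApp.IH(2)[of s] by auto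
next
  case (NCase \<phi> x)
  then show ?case using nfv_push[of "s x" "map (\<lambda>u. nsubst u s) \<phi>"] by auto blast
qed auto

lemma nlift_exhaust:
  assumes "0 \<notin> nfv t"
  obtains a where "t = nlift a"
proof
  show "t = nlift (nrename t (\<lambda>i. i - 1))"
    unfolding nrename_nrename using assms
    by (intro nrename_ident[symmetric]) (auto, metis Suc_pred not_gr_zero)
qed

lemma nlift_inject [simp]: "nlift t = nlift u \<longleftrightarrow> t = u"
proof
  assume "nlift t = nlift u"
  then have "nrename (nlift t) (\<lambda>i. i - 1) = nrename (nlift u) (\<lambda>i. i - 1)" by simp
  then show "t = u" by (simp add: nrename_nrename comp_def nrename_ident)
qed simp

lemma size_nrename [simp]: "size (nrename t r) = size t"
  by (induction t arbitrary: r) (auto simp: size_list_conv_sum_list comp_def cong: map_cong)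

abbreviation ninst :: "nform \<Rightarrow> nform \<Rightarrow> nform" where
  "ninst t u \<equiv> nsubst t (case_nat u NVar)"

lemma nsubst_nlift: "nsubst (nlift t) (case_nat u s) = nsubst t s"
  by (simp add: nsubst_nrename comp_def)

lemma nsubst_ninst:
  "nsubst (ninst t u) s = ninst (nsubst t (case_nat (NVar 0) (\<lambda>i. nlift (s i)))) (nsubst u s)"
  by (simp add: nsubst_nsubst)
    (rule arg_cong[where f = "nsubst t"], auto simp: nsubst_nlift split: nat.split)

lemma nrename_ninst:
  "nrename (ninst t u) r = ninst (nrename t (case_nat 0 (Suc \<circ> r))) (nrename u r)"
  by (simp add: nrename_nsubst nsubst_nrename)
    (rule arg_cong[where f = "nsubst t"], auto split: nat.split)

text \<open>The lifted \<theta> avoids the instantiated variable, and a case on an application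
  leaves the argument alone. So pushing into a beta-redex gives a beta-redex whose contractum is the
  pushed one.\<close>

lemma push_ninst: "push (ninst t u) \<theta> = ninst (push t (map nlift \<theta>)) u"
  by (simp add: nsubst_push comp_def nsubst_nlift)

section \<open>Parallel beta-eta reduction\<close>

inductive par :: "nform \<Rightarrow> nform \<Rightarrow> bool" where
  par_NVar: "par (NVar i) (NVar i)"
| par_NCon: "par (NCon c) (NCon c)"
| par_NFail: "par NFail NFail"
| par_NApp: "par t t' \<Longrightarrow> par u u' \<Longrightarrow> par (NApp t u) (NApp t' u')"
| par_NLam: "par t t' \<Longrightarrow> par (NLam t) (NLam t')"
| par_NCase: "list_all2 par \<phi> \<phi>' \<Longrightarrow> par (NCase \<phi> x) (NCase \<phi>' x)"
| par_beta: "par t t' \<Longrightarrow> par u u' \<Longrightarrow> par (NApp (NLam t) u) (ninst t' u')"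
| par_eta: "par t t' \<Longrightarrow> par (NLam (NApp (nlift t) (NVar 0))) t'"
monos list_all2_mono

lemma par_refl [simp]: "par t t"
  by (induction t) (auto intro: par.intros list.rel_refl_strong)

lemma par_nrename: "par t t' \<Longrightarrow> par (nrename t r) (nrename t' r)"
proof (induction arbitrary: r rule: par.induct)
  case (par_NCase \<phi> \<phi>' x)
  then show ?case by (auto intro!: par.intros simp: list_all2_conv_all_nth)
next
  case (par_beta t t' u u')
  then show ?case by (auto simp: nrename_ninst intro: par.intros)
next
  case (par_eta t t')
  then show ?case by (auto simp flip: nlift_nrename intro: par.intros)
qed (auto intro: par.intros)

lemma par_push:
  assumes "par t t'" "list_all2 par \<theta> \<theta>'"
  shows "par (push t \<theta>) (push t' \<theta>')"
  using assms
proof (induction arbitrary: \<theta> \<theta>' rule: par.induct)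
  case (par_NLam t t')
  have "list_all2 par (map nlift \<theta>) (map nlift \<theta>')"
    using par_NLam.prems by (auto simp: list_all2_conv_all_nth intro: par_nrename)
  then show ?case using par_NLam.IH by (auto intro: par.intros)
next
  case (par_NCase \<phi> \<phi>' x)
  then show ?case by (auto intro!: par.intros simp: list_all2_conv_all_nth)
next
  case (par_beta t t' u u')
  have "list_all2 par (map nlift \<theta>) (map nlift \<theta>')"
    using par_beta.prems by (auto simp: list_all2_conv_all_nth intro: par_nrename)
  then show ?case using par_beta.IH(1) par_beta.hyps by (auto simp: push_ninst intro!: par.intros)
next
  \<comment> \<open>Only the function part of the body receives \<theta>, so the result is the
    eta-redex of \<open>push t \<theta>\<close>.\<close>
  case (par_eta t t')
  then show ?case by (auto simp flip: nrename_push intro: par.intros)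
qed (auto intro: par.intros simp: list_all2_conv_all_nth)

lemma par_nsubst:
  assumes "par t t'" "\<And>i. par (s i) (s' i)"
  shows "par (nsubst t s) (nsubst t' s')"
  using assms
proof (induction arbitrary: s s' rule: par.induct)
  case (par_NLam t t')
  then show ?case by (auto intro!: par.intros par_NLam.IH par_nrename split: nat.split)
next
  case (par_NCase \<phi> \<phi>' x)
  then show ?case by (auto intro!: par_push simp: list_all2_conv_all_nth)
next
  case (par_beta t t' u u')
  have "par (nsubst t (case_nat (NVar 0) (\<lambda>i. nlift (s i))))
     (nsubst t' (case_nat (NVar 0) (\<lambda>i. nlift (s' i))))"
    by (rule par_beta.IH(1)) (auto split: nat.split intro: par_nrename par_beta.prems)
  then show ?case using par_beta by (auto simp: nsubst_ninst intro!: par.intros)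
next
  case (par_eta t t')
  then show ?case by (auto simp flip: nlift_nsubst intro: par.intros)
qed (auto intro: par.intros)

lemma par_ninst: "par t t' \<Longrightarrow> par u u' \<Longrightarrow> par (ninst t u) (ninst t' u')"
  by (auto intro!: par_nsubst split: nat.split)

section \<open>Inversion and the diamond property\<close>

inductive_cases par_NVarE: "par (NVar i) v"
inductive_cases par_NConE: "par (NCon c) v"
inductive_cases par_NFailE: "par NFail v"
inductive_cases par_NAppE [consumes 1, case_names app beta]: "par (NApp t u) v"
inductive_cases par_NLamE [consumes 1, case_names lam eta]: "par (NLam t) v"
inductive_cases par_NCaseE: "par (NCase \<phi> x) v"

text \<open>\<open>case_nat 0 (Suc \<circ> r)\<close> sends only 0 to 0, so the absence of index 0
  is reflected by the renaming.\<close>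

lemma nrename_eq_nlift:
  assumes "nrename t (case_nat 0 (Suc \<circ> r)) = nlift a"
  obtains b where "t = nlift b" "a = nrename b r"
proof -
  have "0 \<notin> nfv (nrename t (case_nat 0 (Suc \<circ> r)))"
    unfolding assms by (auto simp: nfv_nrename)
  then have "0 \<notin> nfv t" by (force simp: nfv_nrename)
  then obtain b where b: "t = nlift b" by (rule nlift_exhaust)
  with assms have "a = nrename b r" by (simp flip: nlift_nrename)
  with b that show thesis by blast
qed

text \<open>Renaming creates no redexes, even if \<open>r\<close> is not injective: beta compares no
  variables, and eta only looks at the bound index, to which no other index is sent.\<close>

lemma par_nrename_left:
  assumes "par (nrename t r) v"
  shows "\<exists>t'. v = nrename t' r \<and> par t t'"
  using assms
proof (induction "nrename t r" v arbitrary: t r rule: par.induct)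
  case (par_NVar i)
  then show ?case by (metis par_refl)
next
  case (par_NCon c)
  then show ?case by (metis par_refl)
next
  case par_NFail
  then show ?case by (metis par_refl)
next
  case (par_NApp a a' b b')
  then obtain c d where t: "t = NApp c d" "a = nrename c r" "b = nrename d r"
    by (cases t) auto
  with par_NApp(2,4) show ?case by (metis nrename.simps(4) par.par_NApp)
next
  case (par_NLam a a')
  then obtain c where t: "t = NLam c" "a = nrename c (case_nat 0 (Suc \<circ> r))"
    by (cases t) auto
  with par_NLam(2) show ?case by (metis nrename.simps(5) par.par_NLam)
next
  case (par_NCase \<phi> \<phi>' x)
  then obtain \<psi> y where t: "t = NCase \<psi> y" "\<phi> = map (\<lambda>u. nrename u r) \<psi>" "x = r y"
    by (cases t) auto
  then have len: "length \<phi>' = length \<psi>" using par_NCase(1) by (auto dest: list_all2_lengthD)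
  have "\<exists>v. \<phi>' ! j = nrename v r \<and> par (\<psi> ! j) v" if "j < length \<psi>" for j
    using par_NCase(1) that unfolding t by (auto simp: list_all2_conv_all_nth)
  then obtain f where f: "\<And>j. j < length \<psi> \<Longrightarrow> \<phi>' ! j = nrename (f j) r \<and> par (\<psi> ! j) (f j)"
    by metis
  have "NCase \<phi>' x = nrename (NCase (map f [0..<length \<psi>]) y) r"
    using f len t by (auto intro!: nth_equalityI)
  moreover have "par t (NCase (map f [0..<length \<psi>]) y)"
    using f t by (auto intro!: par.intros simp: list_all2_conv_all_nth)
  ultimately show ?case by blast
next
  case (par_beta a a' b b')
  then obtain f d where f: "t = NApp f d" "nrename f r = NLam a" "b = nrename d r"
    by (cases t) auto
  then obtain c where t: "t = NApp (NLam c) d" "a = nrename c (case_nat 0 (Suc \<circ> r))"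
    by (cases f) auto
  obtain c' where c': "a' = nrename c' (case_nat 0 (Suc \<circ> r))" "par c c'"
    using par_beta t by metis
  obtain d' where d': "b' = nrename d' r" "par d d'"
    using par_beta f by metis
  show ?case
    unfolding t c' d' nrename_ninst[symmetric] using c' d' by (blast intro: par.intros)
next
  case (par_eta a a')
  then obtain c where t: "t = NLam c" "nrename c (case_nat 0 (Suc \<circ> r)) = NApp (nlift a) (NVar 0)"
    by (cases t) auto
  then obtain d e where c: "c = NApp d e" "nrename d (case_nat 0 (Suc \<circ> r)) = nlift a"
    "nrename e (case_nat 0 (Suc \<circ> r)) = NVar 0"
    by (cases c) auto
  then have e: "e = NVar 0" by (cases e) (auto split: nat.splits)
  obtain b where b: "d = nlift b" "a = nrename b r"
    using c(2) by (rule nrename_eq_nlift)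
  with par_eta(2) obtain b' where "a' = nrename b' r" "par b b'" by blast
  then show ?case using t c e b by (auto intro: par.intros)
qed

text \<open>The overlap of eta with beta: the body of an eta-redex can itself be a beta-redex. Then
  \<open>a\<close> is an abstraction, and \<open>NLam v\<close> is one of its reducts.\<close>

lemma par_eta_body:
  assumes "par (NApp (nlift a) (NVar 0)) v"
  obtains (app) a' where "v = NApp (nlift a') (NVar 0)" "par a a'"
  | (beta) q q' where "a = NLam q" "par q q'" "v = q'"
  using assms
proof (cases rule: par_NAppE)
  case (app t' u')
  then have "u' = NVar 0" by (auto elim: par_NVarE)
  with app that(1) show ?thesis by (auto dest: par_nrename_left)
next
  case (beta p p' u')
  then obtain q where q: "a = NLam q" "p = nrename q (case_nat 0 (Suc \<circ> Suc))"
    by (cases a) auto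
  then obtain q' where q': "p' = nrename q' (case_nat 0 (Suc \<circ> Suc))" "par q q'"
    using beta par_nrename_left by blast
  have "u' = NVar 0" using beta by (auto elim: par_NVarE)
  \<comment> \<open>Instantiating the bound variable by index 0 undoes the shift that
    \<open>nlift\<close> made under the binder.\<close>
  moreover have "case_nat (NVar 0) NVar \<circ> case_nat 0 (Suc \<circ> Suc) = NVar"
    by (auto split: nat.split)
  ultimately have "v = q'" using beta q' by (simp add: nsubst_nrename)
  with q q' that(2) show ?thesis by blast
qed

text \<open>Induction on size, because one overlap uses the hypothesis at a term
  \<open>NApp q u\<close> that is smaller than \<open>s\<close> but not a subterm of it.\<close>

lemma par_diamond: "par s a \<Longrightarrow> par s b \<Longrightarrow> \<exists>c. par a c \<and> par b c"
proof (induction "size s" arbitrary: s a b rule: less_induct)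
  case less
  have IH: "\<exists>c. par a c \<and> par b c" if "size u < size s" "par u a" "par u b" for u a b
    using less.hyps that by blast
  show ?case
  proof (cases s)
    case (NCase \<phi> x)
    obtain \<phi>1 \<phi>2 where ab: "a = NCase \<phi>1 x" "b = NCase \<phi>2 x"
      and r: "list_all2 par \<phi> \<phi>1" "list_all2 par \<phi> \<phi>2"
      using less.prems NCase by (auto elim!: par_NCaseE)
    have "\<exists>c. par (\<phi>1 ! j) c \<and> par (\<phi>2 ! j) c" if "j < length \<phi>" for j
    proof (rule IH)
      have "\<phi> ! j \<in> set \<phi>" using that by simp
      then show "size (\<phi> ! j) < size s"
        using NCase size_list_estimation'[of "\<phi> ! j" \<phi> "size (\<phi> ! j)" size] by simp
    qed (use r that in \<open>auto simp: list_all2_conv_all_nth\<close>)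
    then obtain f where f: "\<And>j. j < length \<phi> \<Longrightarrow> par (\<phi>1 ! j) (f j) \<and> par (\<phi>2 ! j) (f j)"
      by metis
    then show ?thesis
      using r unfolding ab
      by (intro exI[of _ "NCase (map f [0..<length \<phi>]) x"])
        (auto intro!: par.intros simp: list_all2_conv_all_nth)
  next
    case (NLam p)
    \<comment> \<open>Eta against a reduction inside the abstraction, stated once for both
      orders.\<close>
    have eta_join: "\<exists>c. par (NLam p') c \<and> par q' c"
      if p: "p = NApp (nlift q) (NVar 0)" and q: "par q q'" and p': "par p p'" for q q' p'
      using p' unfolding p
    proof (cases rule: par_eta_body)
      case (app q'')
      with IH[of q q' q''] q NLam p show ?thesis by (auto intro: par.intros)
    next
      \<comment> \<open>Here \<open>NLam p'\<close> is a reduct of \<open>q\<close>, so the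
        hypothesis for \<open>q\<close> closes the diagram.\<close>
      case (beta r r')
      with IH[of q q' "NLam r'"] q NLam p show ?thesis by (auto intro: par.intros)
    qed
    from less.prems(1)[unfolded NLam] show ?thesis
    proof (cases rule: par_NLamE)
      case a: (lam p1)
      from less.prems(2)[unfolded NLam] show ?thesis
      proof (cases rule: par_NLamE)
        case (lam p2)
        with a IH[of p p1 p2] NLam show ?thesis by (auto intro: par.intros)
      next
        case (eta q)
        with a eta_join show ?thesis by blast
      qed
    next
      case a: (eta q1)
      from less.prems(2)[unfolded NLam] show ?thesis
      proof (cases rule: par_NLamE)
        case (lam p2)
        with a eta_join show ?thesis by blast
      next
        case (eta q)
        with a IH[of q a b] NLam show ?thesis by auto
      qed
    qed
  next
    case (NApp f u)
    \<comment> \<open>Beta against separate reductions of function and argument, where the function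
      may itself be contracted by eta.\<close>
    have beta_join: "\<exists>c. par (NApp f' u') c \<and> par (ninst p' u'') c"
      if f: "f = NLam p" and f': "par f f'" and u: "par u u'" "par u u''" and p: "par p p'"
      for f' u' u'' p p'
    proof -
      obtain uc where uc: "par u' uc" "par u'' uc" using IH[of u u' u''] u NApp by auto
      from f'[unfolded f] show ?thesis
      proof (cases rule: par_NLamE)
        case (lam p2)
        with IH[of p p' p2] f p NApp obtain pc where "par p' pc" "par p2 pc" by auto
        with lam uc show ?thesis by (auto intro: par.intros par_ninst)
      next
        case (eta q)
        from p[unfolded eta] show ?thesis
        proof (cases rule: par_eta_body)
          case (app q')
          with eta IH[of q f' q'] f NApp obtain qc where "par f' qc" "par q' qc" by auto
          with app uc show ?thesis by (auto simp: nsubst_nlift intro: par.intros)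
        next
          case r: (beta r r')
          \<comment> \<open>The eta-redex \<open>NLam p\<close> contracts to \<open>q\<close>, and contracting its inner beta-redex instead makes
            \<open>ninst p' u''\<close> a reduct of the smaller term \<open>NApp q u\<close>.\<close>
          have "par (NApp q u) (NApp f' u')" using eta u by (auto intro: par.intros)
          moreover have "par (NApp q u) (ninst p' u'')" using r u by (auto intro: par.intros)
          ultimately show ?thesis
            using IH[of "NApp q u"] f eta NApp by auto
        qed
      qed
    qed
    from less.prems(1)[unfolded NApp] show ?thesis
    proof (cases rule: par_NAppE)
      case a: (app f1 u1)
      from less.prems(2)[unfolded NApp] show ?thesis
      proof (cases rule: par_NAppE)
        case (app f2 u2)
        then show ?thesis
          using a IH[of f f1 f2] IH[of u u1 u2] NApp by (auto intro: par.intros)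
      next
        case (beta p p2 u2)
        with a beta_join show ?thesis by blast
      qed
    next
      case a: (beta p p1 u1)
      from less.prems(2)[unfolded NApp] show ?thesis
      proof (cases rule: par_NAppE)
        case (app f2 u2)
        with a beta_join show ?thesis by blast
      next
        case (beta p' p2 u2)
        then show ?thesis
          using a IH[of p p1 p2] IH[of u u1 u2] NApp by (auto intro!: par_ninst)
      qed
    qed
  qed (use less.prems in \<open>auto elim!: par_NVarE par_NConE par_NFailE intro: par.intros\<close>)
qed

section \<open>Conversion\<close>

abbreviation nconv :: "nform \<Rightarrow> nform \<Rightarrow> bool" (infix "\<approx>" 50) where
  "t \<approx> u \<equiv> equivclp par t u"

text \<open>Church-Rosser, from the diamond property through semiconfluence.\<close>

lemma nconv_imp_joinable:
  assumes "t \<approx> u"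
  obtains v where "par\<^sup>*\<^sup>* t v" "par\<^sup>*\<^sup>* u v"
proof -
  have "strong_confluentp par"
    by (rule strong_confluentpI) (use par_diamond in blast)
  then have "semiconfluentp par" by (rule strong_confluentp_into_semiconfluentp)
  with assms that show thesis
    by (auto simp: semiconfluentp_equivclp rtranclp_conversep)
qed

lemma nconv_map:
  assumes "t \<approx> u" "\<And>a b. par a b \<Longrightarrow> par (f a) (f b)"
  shows "f t \<approx> f u"
  using assms(1)
proof (induction rule: equivclp_induct)
  case (step y z)
  then show ?case using assms(2) by (meson equivclp_into_equivclp)
qed simp

lemma nconv_NApp: "t \<approx> t' \<Longrightarrow> u \<approx> u' \<Longrightarrow> NApp t u \<approx> NApp t' u'"
  using nconv_map[of t t' "\<lambda>a. NApp a u"] nconv_map[of u u' "NApp t'"]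
  by (meson equivclp_trans par_NApp par_refl)

lemma nconv_NLam: "t \<approx> t' \<Longrightarrow> NLam t \<approx> NLam t'"
  by (rule nconv_map) (auto intro: par.intros)

text \<open>Conversions of different branches may differ in length and direction, so branches are
  converted one after the other; the prefix \<open>\<psi>\<close> holds those already done.\<close>

lemma nconv_NCase:
  assumes "list_all2 (\<approx>) \<phi> \<phi>'"
  shows "NCase \<phi> x \<approx> NCase \<phi>' x"
proof -
  have "NCase (\<psi> @ \<phi>) x \<approx> NCase (\<psi> @ \<phi>') x" for \<psi>
    using assms
  proof (induction arbitrary: \<psi> rule: list_all2_induct)
    case (Cons t ts t' ts')
    have "NCase (\<psi> @ t # ts) x \<approx> NCase (\<psi> @ t' # ts) x"
      by (rule nconv_map[OF Cons(1)])
        (auto intro!: par.intros list_all2_appendI list.rel_refl)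
    also have "\<dots> \<approx> NCase (\<psi> @ t' # ts') x"
      using Cons(3)[of "\<psi> @ [t']"] by simp
    finally show ?case .
  qed simp
  from this[of "[]"] show ?thesis by simp
qed

lemma nconv_nrename: "t \<approx> t' \<Longrightarrow> nrename t r \<approx> nrename t' r"
  by (erule nconv_map) (rule par_nrename)

lemma nconv_push:
  assumes "t \<approx> t'" "list_all2 (\<approx>) \<theta> \<theta>'"
  shows "push t \<theta> \<approx> push t' \<theta>'"
proof -
  have "push t \<theta> \<approx> push t \<theta>'"
    using assms(2)
  proof (induction t arbitrary: \<theta> \<theta>')
    case (NVar x)
    then show ?case by (simp add: nconv_NCase)
  next
    case (NCon c)
    then show ?case by (auto simp: list_all2_conv_all_nth)
  next
    case (NApp t1 t2)
    then show ?case by (simp add: nconv_NApp)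
  next
    case (NLam t)
    have "list_all2 (\<approx>) (map nlift \<theta>) (map nlift \<theta>')"
      using NLam.prems by (auto simp: list_all2_conv_all_nth intro: nconv_nrename)
    with NLam.IH show ?case by (simp add: nconv_NLam)
  next
    case (NCase \<phi> x)
    then show ?case by (auto intro!: nconv_NCase simp: list_all2_conv_all_nth)
  qed simp
  also have "\<dots> \<approx> push t' \<theta>'"
    by (rule nconv_map[OF assms(1)]) (simp add: par_push list.rel_refl)
  finally show ?thesis .
qed

text \<open>The substitutions are compared on the variables of \<open>t\<close> only, since the
  components of an arrow beyond its codomain are unspecified.\<close>

lemma nconv_nsubst:
  assumes "t \<approx> t'" "\<And>i. i \<in> nfv t \<Longrightarrow> s i \<approx> s' i"
  shows "nsubst t s \<approx> nsubst t' s'"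
proof -
  have "nsubst t s \<approx> nsubst t s'"
    using assms(2)
  proof (induction t arbitrary: s s')
    case (NApp t1 t2)
    then show ?case by (simp add: nconv_NApp)
  next
    case (NLam t)
    have "nsubst t (case_nat (NVar 0) (\<lambda>i. nlift (s i)))
        \<approx> nsubst t (case_nat (NVar 0) (\<lambda>i. nlift (s' i)))"
      by (rule NLam.IH) (use NLam.prems in \<open>auto split: nat.split intro: nconv_nrename\<close>)
    then show ?case by (simp add: nconv_NLam)
  next
    case (NCase \<phi> x)
    have "nsubst u s \<approx> nsubst u s'" if "u \<in> set \<phi>" for u
      by (rule NCase.IH[OF that], rule NCase.prems) (use that in auto)
    with NCase.prems show ?case
      by (auto intro!: nconv_push simp: list_all2_conv_all_nth)
  qed simp_all
  also have "\<dots> \<approx> nsubst t' s'"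
    by (rule nconv_map[OF assms(1)]) (auto intro: par_nsubst)
  finally show ?thesis .
qed

lemma nconv_eta: "NLam (NApp (nlift t) (NVar 0)) \<approx> t"
  by (rule r_into_equivclp, rule par_eta) simp

lemma nconv_beta: "NApp (NLam t) u \<approx> ninst t u"
  by (rule r_into_equivclp, rule par_beta) simp_all

section \<open>The term model\<close>

primrec lams :: "nat \<Rightarrow> nform \<Rightarrow> nform" where
  "lams 0 t = t"
| "lams (Suc k) t = lams k (NLam t)"

text \<open>The arguments are \<open>NVar (k - 1)\<close> down to \<open>NVar 0\<close>, the order
  in which \<open>lams k\<close> binds them from the outside in. So \<open>lams\<close> realises
  currying and \<open>apps\<close> evaluation.\<close>

primrec apps :: "nat \<Rightarrow> nform \<Rightarrow> nform" where
  "apps 0 t = t"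
| "apps (Suc k) t = apps k (NApp t (NVar k))"

lemma lams_Suc: "lams (Suc k) t = NLam (lams k t)"
  by (induction k arbitrary: t) auto

lemma apps_Suc_nlift: "apps (Suc k) (nlift t) = NApp (nlift (apps k t)) (NVar 0)"
proof (induction k arbitrary: t)
  case (Suc k)
  from Suc[of "NApp t (NVar k)"] show ?case by simp
qed simp

lemma nconv_apps: "t \<approx> u \<Longrightarrow> apps k t \<approx> apps k u"
  by (induction k arbitrary: t u) (simp_all add: nconv_NApp)

lemma nconv_lams: "t \<approx> u \<Longrightarrow> lams k t \<approx> lams k u"
  by (induction k arbitrary: t u) (auto intro: nconv_NLam)

text \<open>Beta, \<open>k\<close> times; this gives the law for evaluating a curried arrow.\<close>

lemma apps_lams: "apps k (nrename (lams k t) (\<lambda>i. i + k)) \<approx> t"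
proof (induction k)
  case 0
  then show ?case by (simp add: nrename_ident)
next
  case (Suc k)
  let ?u = "nrename (lams k t) (case_nat 0 (Suc \<circ> (\<lambda>i. i + Suc k)))"
  have "apps (Suc k) (nrename (lams (Suc k) t) (\<lambda>i. i + Suc k)) = apps k (NApp (NLam ?u) (NVar k))"
    by (simp add: lams_Suc del: lams.simps)
  also have "\<dots> \<approx> apps k (ninst ?u (NVar k))"
    by (rule nconv_apps) (rule nconv_beta)
  \<comment> \<open>The outermost variable becomes \<open>NVar k\<close>, which is where the shift
    by \<open>k\<close> sends index 0.\<close>
  also have "ninst ?u (NVar k) = nsubst (lams k t) (\<lambda>i. NVar (i + k))"
    unfolding nsubst_nrename
    by (rule arg_cong[where f = "nsubst (lams k t)"]) (auto split: nat.split)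
  also have "\<dots> = nrename (lams k t) (\<lambda>i. i + k)" by (rule nsubst_NVar_comp)
  also note Suc
  finally show ?case .
qed

text \<open>Eta, \<open>k\<close> times; this gives uniqueness of currying.\<close>

lemma lams_apps: "lams k (apps k (nrename t (\<lambda>i. i + k))) \<approx> t"
proof (induction k)
  case 0
  then show ?case by (simp add: nrename_ident)
next
  case (Suc k)
  have "nrename t (\<lambda>i. i + Suc k) = nlift (nrename t (\<lambda>i. i + k))"
    by (simp add: nrename_nrename comp_def)
  then have "lams (Suc k) (apps (Suc k) (nrename t (\<lambda>i. i + Suc k)))
      = lams k (NLam (NApp (nlift (apps k (nrename t (\<lambda>i. i + k)))) (NVar 0)))"
    by (simp only: apps_Suc_nlift lams.simps)
  also have "\<dots> \<approx> lams k (apps k (nrename t (\<lambda>i. i + k)))"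
    by (rule nconv_lams) (rule nconv_eta)
  also note Suc
  finally show ?case .
qed

lemma nsubst_apps:
  assumes "\<And>i. i < k \<Longrightarrow> s i = NVar i"
  shows "nsubst (apps k t) s = apps k (nsubst t s)"
  using assms by (induction k arbitrary: t) auto

lemma nfv_apps: "nfv (apps k t) = nfv t \<union> {..<k}"
  by (induction k arbitrary: t) auto

lemma nfv_lams: "nfv (lams k t) = {i. i + k \<in> nfv t}"
  by (induction k arbitrary: t) auto

text \<open>Representatives instead of classes keep the codes of arrows in a countable type, which
  \<open>nform set\<close> is not.\<close>

definition nrep :: "nform \<Rightarrow> nform" where
  "nrep t = (SOME u. u \<approx> t)"

lemma nrep_nconv: "nrep t \<approx> t"
  unfolding nrep_def by (rule someI[of _ t]) simp

lemma nrep_eq_iff: "nrep t = nrep u \<longleftrightarrow> t \<approx> u"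
proof
  assume "nrep t = nrep u"
  then show "t \<approx> u" by (metis nrep_nconv equivclp_sym equivclp_trans)
next
  assume "t \<approx> u"
  then have "(\<lambda>v. v \<approx> t) = (\<lambda>v. v \<approx> u)" by (metis equivclp_sym equivclp_trans)
  then show "nrep t = nrep u" by (simp add: nrep_def)
qed

section \<open>Tuples of normal forms and their coding as arrows\<close>

lemma nfv_if_subset [simp]:
  "nfv (if b then t else u) \<subseteq> S \<longleftrightarrow> (b \<longrightarrow> nfv t \<subseteq> S) \<and> (\<not> b \<longrightarrow> nfv u \<subseteq> S)"
  by simp

abbreviation closed_tuple :: "nat \<Rightarrow> nat \<Rightarrow> (nat \<Rightarrow> nform) \<Rightarrow> bool" where
  "closed_tuple X Y f \<equiv> \<forall>i<Y. nfv (f i) \<subseteq> {..<X}"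

lemma closed_tuple_nsubst:
  assumes "closed_tuple X Y f" "closed_tuple Y Z g"
  shows "closed_tuple X Z (\<lambda>i. nsubst (g i) f)"
proof (intro allI impI)
  fix i assume "i < Z"
  with assms nfv_nsubst[of "g i" f] show "nfv (nsubst (g i) f) \<subseteq> {..<X}" by force
qed

text \<open>The models range over two given infinite types, so objects and arrows are transported
  into them along injections.\<close>

locale term_model =
  fixes eo :: "nat \<Rightarrow> 'o" and em :: "nat \<times> nat \<times> nform list \<Rightarrow> 'm" and n :: nat
  assumes inj_eo: "inj eo" and inj_em: "inj em"
begin

text \<open>The domain is part of the code because the normal forms do not determine how many
  variables are available.\<close>

definition arr :: "nat \<Rightarrow> nat \<Rightarrow> (nat \<Rightarrow> nform) \<Rightarrow> 'm" where
  "arr X Y f = em (X, Y, map (\<lambda>i. nrep (f i)) [0..<Y])"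

definition ob :: "'o \<Rightarrow> nat" where "ob = inv eo"
definition src :: "'m \<Rightarrow> nat" where "src a = fst (inv em a)"
definition tgt :: "'m \<Rightarrow> nat" where "tgt a = fst (snd (inv em a))"
definition ent :: "'m \<Rightarrow> nat \<Rightarrow> nform" where "ent a i = snd (snd (inv em a)) ! i"

text \<open>Index 0 is the argument of the case. Component \<open>j\<close> of the binding is the
  variable \<open>n - 1 - j\<close>, shifted by one past that argument.\<close>

definition cas_body :: nform where
  "cas_body = NCase (map (\<lambda>j. NVar (Suc (n - Suc j))) [0..<n]) 0"

text \<open>
  The object \<open>eo k\<close> is \<open>D\<^sup>k\<close>. An arrow \<open>arr X Y f\<close> assigns to each variable \<open>i < Y\<close> a normal form
  in the variables \<open>j < X\<close>. In a product the last factor has the smallest indices, as in a de Bruijn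
  context, so component \<open>j\<close> of \<open>D\<^sup>k\<close> is the variable \<open>k - 1 - j\<close>. Currying binds the \<open>A\<close> smallest
  variables in each component, hence the exponential \<open>B\<^sup>A\<close> is \<open>B\<close> itself.
\<close>

definition M :: "('o, 'm) lc_model" where
  "M = \<lparr>
    Obj = range eo,
    Arr = {arr X Y f | X Y f. closed_tuple X Y f},
    Dom = \<lambda>a. eo (src a),
    Cod = \<lambda>a. eo (tgt a),
    Id = \<lambda>A. arr (ob A) (ob A) NVar,
    Comp = \<lambda>a b. arr (src a) (tgt b) (\<lambda>i. nsubst (ent b i) (ent a)),
    One = eo 0,
    Bang = \<lambda>A. arr (ob A) 0 NVar,
    Prod = \<lambda>A B. eo (ob A + ob B),
    P1 = \<lambda>A B. arr (ob A + ob B) (ob A) (\<lambda>i. NVar (i + ob B)),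
    P2 = \<lambda>A B. arr (ob A + ob B) (ob B) NVar,
    Pairing = \<lambda>a b. arr (src a) (tgt a + tgt b)
      (\<lambda>i. if i < tgt b then ent b i else ent a (i - tgt b)),
    Exp = \<lambda>A B. B,
    Ev = \<lambda>A B. arr (ob B + ob A) (ob B) (\<lambda>i. apps (ob A) (NVar (i + ob A))),
    Curry = \<lambda>X A a. arr (ob X) (tgt a) (\<lambda>i. lams (ob A) (ent a i)),
    D = eo (Suc 0),
    app = arr (Suc 0) (Suc 0) NVar,
    lam = arr (Suc 0) (Suc 0) NVar,
    con = \<lambda>c. arr 0 (Suc 0) (\<lambda>_. NCon c),
    fail = arr 0 (Suc 0) (\<lambda>_. NFail),
    cas = arr (Suc n) (Suc 0) (\<lambda>_. cas_body)\<rparr>"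

lemma ob_eo [simp]: "ob (eo X) = X"
  using inj_eo by (simp add: ob_def)

lemma eo_eq_iff [simp]: "eo X = eo Y \<longleftrightarrow> X = Y"
  using inj_eo by (auto dest: injD)

lemma src_arr [simp]: "src (arr X Y f) = X"
  and tgt_arr [simp]: "tgt (arr X Y f) = Y"
  using inj_em by (simp_all add: src_def tgt_def arr_def)

lemma ent_arr: "i < Y \<Longrightarrow> ent (arr X Y f) i \<approx> f i"
  using inj_em nrep_nconv by (simp add: ent_def arr_def)

lemma arr_eq_iff: "arr X Y f = arr X' Y' g \<longleftrightarrow> X = X' \<and> Y = Y' \<and> (\<forall>i<Y. f i \<approx> g i)"
  using inj_em by (auto simp: arr_def nrep_eq_iff inj_eq)

lemma arr_cong: "(\<And>i. i < Y \<Longrightarrow> f i \<approx> g i) \<Longrightarrow> arr X Y f = arr X Y g"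
  by (simp add: arr_eq_iff)

lemma M_simps [simp]:
  "Obj M = range eo"
  "Dom M a = eo (src a)"
  "Cod M a = eo (tgt a)"
  "Id M (eo X) = arr X X NVar"
  "One M = eo 0"
  "Bang M (eo X) = arr X 0 NVar"
  "eo X \<otimes>\<^bsub>M\<^esub> eo Y = eo (X + Y)"
  "P1 M (eo X) (eo Y) = arr (X + Y) X (\<lambda>i. NVar (i + Y))"
  "P2 M (eo X) (eo Y) = arr (X + Y) Y NVar"
  "Exp M A B = B"
  "Ev M (eo X) (eo Y) = arr (Y + X) Y (\<lambda>i. apps X (NVar (i + X)))"
  "D M = eo (Suc 0)"
  "app M = arr (Suc 0) (Suc 0) NVar"
  "lam M = arr (Suc 0) (Suc 0) NVar"
  "con M c = arr 0 (Suc 0) (\<lambda>_. NCon c)"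
  "fail M = arr 0 (Suc 0) (\<lambda>_. NFail)"
  "cas M = arr (Suc n) (Suc 0) (\<lambda>_. cas_body)"
  by (simp_all add: M_def)

lemma Hom_iff: "a \<in> Hom M A B \<longleftrightarrow>
    (\<exists>X Y f. a = arr X Y f \<and> A = eo X \<and> B = eo Y \<and> closed_tuple X Y f)"
  by (auto simp: Hom_def M_def)

lemma Hom_arr: "closed_tuple X Y f \<Longrightarrow> arr X Y f \<in> Hom M (eo X) (eo Y)"
  by (auto simp: Hom_iff)

lemma Comp_arr [simp]:
  assumes "closed_tuple Y Z g"
  shows "arr X Y f \<Zsemi>\<^bsub>M\<^esub> arr Y Z g = arr X Z (\<lambda>i. nsubst (g i) f)"
proof -
  have "nsubst (ent (arr Y Z g) i) (ent (arr X Y f)) \<approx> nsubst (g i) f" if "i < Z" for i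
  proof (rule equivclp_trans)
    show "nsubst (ent (arr Y Z g) i) (ent (arr X Y f)) \<approx> nsubst (g i) (ent (arr X Y f))"
      by (rule nconv_nsubst) (simp_all add: ent_arr that)
    show "\<dots> \<approx> nsubst (g i) f"
      using assms that by (intro nconv_nsubst) (auto intro!: ent_arr)
  qed
  then show ?thesis by (simp add: M_def arr_eq_iff)
qed

lemma Pairing_arr [simp]:
  "\<langle>arr X A f, arr X' B g\<rangle>\<^bsub>M\<^esub> = arr X (A + B) (\<lambda>i. if i < B then g i else f (i - B))"
  by (auto simp: M_def arr_eq_iff ent_arr)

lemma Curry_arr [simp]:
  "Curry M (eo X) (eo A) (arr Y B f) = arr X B (\<lambda>i. lams A (f i))"
  by (auto simp: M_def arr_eq_iff intro: nconv_lams ent_arr)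

lemma Times_arr [simp]:
  assumes "closed_tuple X A f" "closed_tuple Y B g"
  shows "arr X A f \<otimes>\<^sub>m\<^bsub>M\<^esub> arr Y B g =
    arr (X + Y) (A + B) (\<lambda>i. if i < B then g i else nrename (f (i - B)) (\<lambda>j. j + Y))"
  using assms by (auto simp: Times_def arr_eq_iff nsubst_NVar_comp nrename_ident)

section \<open>The cartesian closed structure\<close>

sublocale ccc M
proof
  fix f assume "f \<in> Arr M"
  then show "Dom M f \<in> Obj M" "Cod M f \<in> Obj M" by simp_all
next
  fix A assume "A \<in> Obj M"
  then show "Id M A \<in> Hom M A A" by (auto intro!: Hom_arr)
next
  fix f g X Y Z assume "f \<in> Hom M X Y" "g \<in> Hom M Y Z"
  then obtain x y z s t where "X = eo x" "Z = eo z" "f = arr x y s" "g = arr y z t"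
    "closed_tuple x y s" "closed_tuple y z t"
    by (auto simp: Hom_iff)
  then show "f \<Zsemi>\<^bsub>M\<^esub> g \<in> Hom M X Z" by (simp add: Hom_arr closed_tuple_nsubst)
next
  fix f X Y assume "f \<in> Hom M X Y"
  then show "Id M X \<Zsemi>\<^bsub>M\<^esub> f = f" "f \<Zsemi>\<^bsub>M\<^esub> Id M Y = f"
    by (auto simp: Hom_iff)
next
  fix f g h X Y Z W assume "f \<in> Hom M X Y" "g \<in> Hom M Y Z" "h \<in> Hom M Z W"
  then show "(f \<Zsemi>\<^bsub>M\<^esub> g) \<Zsemi>\<^bsub>M\<^esub> h = f \<Zsemi>\<^bsub>M\<^esub> (g \<Zsemi>\<^bsub>M\<^esub> h)"
    by (auto simp: Hom_iff nsubst_nsubst closed_tuple_nsubst)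
next
  show "One M \<in> Obj M" by simp
next
  fix X assume "X \<in> Obj M"
  then show "Bang M X \<in> Hom M X (One M)" by (auto intro!: Hom_arr)
next
  fix f X assume "f \<in> Hom M X (One M)"
  then show "f = Bang M X" by (auto simp: Hom_iff arr_eq_iff)
next
  fix A B assume "A \<in> Obj M" "B \<in> Obj M"
  then show "A \<otimes>\<^bsub>M\<^esub> B \<in> Obj M" "P1 M A B \<in> Hom M (A \<otimes>\<^bsub>M\<^esub> B) A" "P2 M A B \<in> Hom M (A \<otimes>\<^bsub>M\<^esub> B) B"
    "Exp M A B \<in> Obj M" "Ev M A B \<in> Hom M (Exp M A B \<otimes>\<^bsub>M\<^esub> A) B"
    by (auto intro!: Hom_arr simp: nfv_apps)
next
  fix f g X A B assume "f \<in> Hom M X A" "g \<in> Hom M X B"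
  then obtain x a b s t where *: "X = eo x" "A = eo a" "B = eo b" "f = arr x a s" "g = arr x b t"
    "closed_tuple x a s" "closed_tuple x b t"
    by (auto simp: Hom_iff)
  from * show "\<langle>f, g\<rangle>\<^bsub>M\<^esub> \<in> Hom M X (A \<otimes>\<^bsub>M\<^esub> B)"
    by (simp add: Hom_arr less_diff_conv2)
  from * show "\<langle>f, g\<rangle>\<^bsub>M\<^esub> \<Zsemi>\<^bsub>M\<^esub> P1 M A B = f" "\<langle>f, g\<rangle>\<^bsub>M\<^esub> \<Zsemi>\<^bsub>M\<^esub> P2 M A B = g"
    by (auto simp: arr_eq_iff)
next
  fix A B h X assume "A \<in> Obj M" "B \<in> Obj M" "h \<in> Hom M X (A \<otimes>\<^bsub>M\<^esub> B)"
  then show "h = \<langle>h \<Zsemi>\<^bsub>M\<^esub> P1 M A B, h \<Zsemi>\<^bsub>M\<^esub> P2 M A B\<rangle>\<^bsub>M\<^esub>"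
    by (auto simp: Hom_iff arr_eq_iff)
next
  fix X A B f assume "X \<in> Obj M" "A \<in> Obj M" "f \<in> Hom M (X \<otimes>\<^bsub>M\<^esub> A) B"
  then obtain x a b t where *: "X = eo x" "A = eo a" "B = eo b" "f = arr (x + a) b t"
    "closed_tuple (x + a) b t"
    by (auto simp: Hom_iff)
  \<comment> \<open>Each of the \<open>a\<close> abstractions lowers the free indices by one,
    turning the bound \<open>x + a\<close> into \<open>x\<close>.\<close>
  have lams: "closed_tuple x b (\<lambda>i. lams a (t i))" proof (intro allI impI subsetI)
    fix i j assume "i < b" "j \<in> nfv (lams a (t i))"
    moreover have "nfv (t i) \<subseteq> {..<x + a}" using *(5) \<open>i < b\<close> by blast
    ultimately have "j + a \<in> {..<x + a}" by (auto simp: nfv_lams)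
    then show "j \<in> {..<x}" by simp
  qed
  with * show "Curry M X A f \<in> Hom M X (Exp M A B)" by (auto intro!: Hom_arr)
  show "(Curry M X A f \<otimes>\<^sub>m\<^bsub>M\<^esub> Id M A) \<Zsemi>\<^bsub>M\<^esub> Ev M A B = f"
    using * lams by (auto simp: nfv_apps arr_eq_iff nsubst_apps apps_lams)
next
  fix X A B g assume "A \<in> Obj M" "B \<in> Obj M" "g \<in> Hom M X (Exp M A B)"
  then show "g = Curry M X A ((g \<otimes>\<^sub>m\<^bsub>M\<^esub> Id M A) \<Zsemi>\<^bsub>M\<^esub> Ev M A B)"
    by (auto simp: Hom_iff nfv_apps arr_eq_iff nsubst_apps intro: equivclp_sym[OF lams_apps])
qed

section \<open>Powers, projections and the model axioms\<close>

lemma Power_eo [simp]: "Power M (eo (Suc 0)) k = eo k"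
  by (induction k) simp_all

lemma Proj_eo: "i < k \<Longrightarrow> Proj M (eo (Suc 0)) k i = arr k (Suc 0) (\<lambda>_. NVar (k - 1 - i))"
proof (induction k)
  case (Suc k)
  then show ?case by (auto simp: arr_eq_iff Suc_diff_Suc)
qed simp

lemma Tuple_arr:
  assumes "\<And>i. i < k \<Longrightarrow> f i = arr X (Suc 0) (\<lambda>_. g i)"
  shows "Tuple M (eo X) f k = arr X k (\<lambda>i. g (k - 1 - i))"
  using assms
proof (induction k)
  case (Suc k)
  then show ?case by (auto simp: arr_eq_iff less_Suc_eq)
qed (simp add: arr_eq_iff)

lemma Assoc_eo [simp]: "Assoc M (eo X) (eo Y) (eo Z) = arr (X + Y + Z) (X + (Y + Z)) NVar"
  by (auto simp: Assoc_def arr_eq_iff)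

lemma nfv_cas_body: "n < m \<Longrightarrow> nfv cas_body \<subseteq> {..<m}"
  by (auto simp: cas_body_def)

lemma nsubst_cas_body: "nsubst cas_body s = push (s 0) (map (\<lambda>j. s (Suc (n - Suc j))) [0..<n])"
  by (simp add: cas_body_def comp_def)

lemma nrename_cas_body: "nrename cas_body r = NCase (map (\<lambda>j. NVar (r (Suc (n - Suc j)))) [0..<n]) (r 0)"
  by (simp add: cas_body_def comp_def)

lemma cas_comp_eq:
  "cas_comp n M = arr (n + n) n (\<lambda>i. NCase (map (\<lambda>j. NVar (n - Suc j + n)) [0..<n]) i)"
proof -
  \<comment> \<open>The projections and the tuple both reverse the numbering, whence the doubled
    subtraction.\<close>
  have "Tuple M (eo (n + n)) (\<lambda>i. (arr n n NVar \<otimes>\<^sub>m\<^bsub>M\<^esub> Proj M (eo (Suc 0)) n i) \<Zsemi>\<^bsub>M\<^esub> cas M) n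
      = arr (n + n) n (\<lambda>i. NCase (map (\<lambda>j. NVar (n - Suc j + n)) [0..<n]) (n - 1 - (n - 1 - i)))"
    by (intro Tuple_arr) (auto simp: nfv_cas_body Proj_eo nsubst_cas_body intro!: arr_cong)
  also have "\<dots> = arr (n + n) n (\<lambda>i. NCase (map (\<lambda>j. NVar (n - Suc j + n)) [0..<n]) i)"
    by (intro arr_cong) simp
  finally show ?thesis by (simp add: cas_comp_def Let_def)
qed

text \<open>D1 holds because \<open>app\<close> and \<open>lam\<close> are identities. D2, D3, D5
  and D6 are \<open>push\<close> evaluated at a constructor, an application, a case and failure; D4
  needs eta.\<close>

lemma lc_model_M: "lc_model n M"
proof (intro lc_model.intro ccc_axioms lc_model_axioms.intro)
  show "cas_hat n M \<Zsemi>\<^bsub>M\<^esub> lam M = (Id M (Power M (D M) n) \<otimes>\<^sub>m\<^bsub>M\<^esub> lam M) \<Zsemi>\<^bsub>M\<^esub> cas M"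
  proof -
    \<comment> \<open>The left side is the eta-expansion of \<open>cas_body\<close>: the case has
      moved into the function part of the application made by evaluation.\<close>
    have "NLam (NApp (NCase (map (\<lambda>j. NVar (Suc (Suc (n - Suc j)))) [0..<n]) (Suc 0)) (NVar 0))
        \<approx> NCase (map (\<lambda>j. NVar (Suc (n - Suc j))) [0..<n]) 0"
      using nconv_eta[of cas_body] unfolding nrename_cas_body by (simp add: cas_body_def)
    then show ?thesis
      by (auto simp: nfv_cas_body cas_hat_def Let_def nfv_nrename nsubst_cas_body intro!: arr_cong)
  qed
  show "(cas_comp n M \<otimes>\<^sub>m\<^bsub>M\<^esub> Id M (D M)) \<Zsemi>\<^bsub>M\<^esub> cas M =
      Assoc M (Power M (D M) n) (Power M (D M) n) (D M) \<Zsemi>\<^bsub>M\<^esub>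
      (Id M (Power M (D M) n) \<otimes>\<^sub>m\<^bsub>M\<^esub> cas M) \<Zsemi>\<^bsub>M\<^esub> cas M"
  proof -
    have *: "\<forall>i<n. nfv (NCase (map (\<lambda>j. NVar (n - Suc j + n)) [0..<n]) i) \<subseteq> {..<n + n}"
      by auto
    show ?thesis
      by (auto simp: cas_comp_eq nfv_nrename nfv_cas_body Times_arr[OF *] nsubst_cas_body
          nrename_cas_body comp_def intro!: arr_cong) (simp add: cas_body_def comp_def)
  qed
  show "\<langle>Id M (Power M (D M) n), Bang M (Power M (D M) n)\<rangle>\<^bsub>M\<^esub> \<Zsemi>\<^bsub>M\<^esub>
      (Id M (Power M (D M) n) \<otimes>\<^sub>m\<^bsub>M\<^esub> con M i) \<Zsemi>\<^bsub>M\<^esub> cas M = Proj M (D M) n i"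
    if "i < n" for i
  proof -
    have *: "closed_tuple n (Suc n)
        (\<lambda>j. if j = 0 then NCon i else nrename (NVar (j - Suc 0)) (\<lambda>j. j + 0))" by auto
    show ?thesis
      using that by (simp add: Comp_arr[OF *] nfv_cas_body Proj_eo nsubst_cas_body)
  qed
  show "(cas M \<otimes>\<^sub>m\<^bsub>M\<^esub> Id M (D M)) \<Zsemi>\<^bsub>M\<^esub> (app M \<otimes>\<^sub>m\<^bsub>M\<^esub> Id M (D M)) \<Zsemi>\<^bsub>M\<^esub> Ev M (D M) (D M) =
      Assoc M (Power M (D M) n) (D M) (D M) \<Zsemi>\<^bsub>M\<^esub>
      (Id M (Power M (D M) n) \<otimes>\<^sub>m\<^bsub>M\<^esub> (app M \<otimes>\<^sub>m\<^bsub>M\<^esub> Id M (D M))) \<Zsemi>\<^bsub>M\<^esub>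
      (Id M (Power M (D M) n) \<otimes>\<^sub>m\<^bsub>M\<^esub> Ev M (D M) (D M)) \<Zsemi>\<^bsub>M\<^esub> cas M"
  proof -
    have *: "closed_tuple (Suc (Suc n)) (Suc (Suc n))
        (\<lambda>i. if i < Suc (Suc 0)
          then if i = 0 then NVar i else nrename (NVar (i - Suc 0)) (\<lambda>j. j + Suc 0)
          else nrename (NVar (i - Suc (Suc 0))) (\<lambda>j. j + Suc (Suc 0)))"
      by auto
    have **: "closed_tuple (Suc (Suc n)) (Suc n)
        (\<lambda>i. if i = 0 then NApp (NVar (Suc i)) (NVar 0)
          else nrename (NVar (i - Suc 0)) (\<lambda>j. j + Suc (Suc 0)))"
      by auto
    show ?thesis
      by (simp add: Comp_arr[OF *] Comp_arr[OF **] nfv_cas_body nsubst_cas_body nrename_cas_body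
          arr_eq_iff comp_def)
  qed
qed (simp_all add: nfv_cas_body Hom_arr nsubst_cas_body nrename_cas_body arr_eq_iff)

end

text \<open>Converts a name of \<Gamma> into a variable of the model, where the last entry of the
  context has index 0.\<close>

definition level :: "nat list \<Rightarrow> nat \<Rightarrow> nat" where
  "level \<Gamma> x = length \<Gamma> - Suc (position \<Gamma> x)"

lemma position_nth:
  assumes "distinct \<Gamma>" "j < length \<Gamma>"
  shows "position \<Gamma> (\<Gamma> ! j) = j"
  unfolding position_def using assms by (intro the_equality) (auto simp: nth_eq_iff_index_eq)

section \<open>Interpretation in the term model\<close>

text \<open>Bindings are filled up with \<open>NFail\<close> to length \<open>n\<close>. Branches
  for constructors from \<open>n\<close> on would be dropped, but terms over the \<open>n\<close>
  constructors have none.\<close>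

primrec case_nf :: "nat \<Rightarrow> trm \<Rightarrow> nform" where
  "case_nf n (Var i) = NVar i"
| "case_nf n (App t u) = NApp (case_nf n t) (case_nf n u)"
| "case_nf n (Lam t) = NLam (case_nf n t)"
| "case_nf n (Con c) = NCon c"
| "case_nf n (Case \<theta> t) = push (case_nf n t)
    (map (\<lambda>c. case fmlookup (fmmap (case_nf n) \<theta>) c of Some u \<Rightarrow> u | None \<Rightarrow> NFail) [0..<n])"

lemma nfv_case_nf: "nfv (case_nf n t) \<subseteq> fv t"
proof (induction t)
  case (Case \<theta> t)
  have "nfv (case_nf n (Case \<theta> t)) \<subseteq> nfv (case_nf n t) \<union> \<Union> (nfv ` set
     (map (\<lambda>c. case fmlookup (fmmap (case_nf n) \<theta>) c of Some u \<Rightarrow> u | None \<Rightarrow> NFail) [0..<n]))"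
    unfolding case_nf.simps by (rule nfv_push)
  also have "\<dots> \<subseteq> fv (Case \<theta> t)"
    using Case by (fastforce simp: fmran'_def ran_def split: option.splits)
  finally show ?case .
qed auto

context term_model
begin

text \<open>Both sides follow the same recursion, because composing with \<open>cas\<close> amounts
  to \<open>push\<close>.\<close>

lemma interp_eq:
  assumes "distinct \<Gamma>" "fv t \<subseteq> set \<Gamma>"
  shows "interp n M t \<Gamma> = arr (length \<Gamma>) (Suc 0) (\<lambda>_. nrename (case_nf n t) (level \<Gamma>))"
  using assms
proof (induction t arbitrary: \<Gamma>)
  case (Var x)
  then obtain j where "j < length \<Gamma>" "\<Gamma> ! j = x" by (auto simp: in_set_conv_nth)
  with Var.prems show ?case by (auto simp: Proj_eo position_nth level_def)
next
  case (App t u)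
  then show ?case by (auto intro!: arr_cong)
next
  case (Lam t)
  have "fv t \<subseteq> set (map Suc \<Gamma> @ [0])"
  proof
    fix i assume "i \<in> fv t"
    with Lam.prems show "i \<in> set (map Suc \<Gamma> @ [0])" by (cases i) auto
  qed
  \<comment> \<open>Appending the bound variable gives it level 0 and raises the other levels by
    one. Agreement on free variables suffices, as \<open>level\<close> is unspecified outside the
    context.\<close>
  moreover have "nrename (case_nf n t) (level (map Suc \<Gamma> @ [0])) =
      nrename (case_nf n t) (case_nat 0 (Suc \<circ> level \<Gamma>))"
  proof (rule nrename_cong)
    fix i assume "i \<in> nfv (case_nf n t)"
    with nfv_case_nf[of n t] have "i \<in> fv t" by blast
    with calculation have "i \<in> set (map Suc \<Gamma> @ [0])" by (rule subsetD)
    then obtain j where j: "j < Suc (length \<Gamma>)" "(map Suc \<Gamma> @ [0]) ! j = i"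
      by (metis in_set_conv_nth length_append_singleton length_map)
    have p: "position (map Suc \<Gamma> @ [0]) i = j"
      using j Lam.prems position_nth[of "map Suc \<Gamma> @ [0]" j] by (simp add: distinct_map)
    then show "level (map Suc \<Gamma> @ [0]) i = case_nat 0 (Suc \<circ> level \<Gamma>) i"
    proof (cases "j = length \<Gamma>")
      case False
      then have "i = Suc (\<Gamma> ! j)" "position \<Gamma> (\<Gamma> ! j) = j"
        using j Lam.prems position_nth[of \<Gamma> j] by (auto simp: nth_append)
      with p show ?thesis using j False by (simp add: level_def)
    qed (use j p in \<open>auto simp: level_def nth_append\<close>)
  qed
  ultimately show ?case
    using Lam.prems Lam.IH[of "map Suc \<Gamma> @ [0]"]
    by (simp add: distinct_map)
next
  case (Con c)
  then show ?case by simp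
next
  case (Case \<theta> t)
  define g where "g i = (case fmlookup (fmmap (case_nf n) \<theta>) i of Some u \<Rightarrow> u | None \<Rightarrow> NFail)" for i
  let ?f = "\<lambda>i. case fmlookup (fmmap (\<lambda>u. interp n M u \<Gamma>) \<theta>) i of
      Some f \<Rightarrow> f | None \<Rightarrow> Bang M (Power M (D M) (length \<Gamma>)) \<Zsemi>\<^bsub>M\<^esub> fail M"
  have "?f i = arr (length \<Gamma>) (Suc 0) (\<lambda>_. nrename (g i) (level \<Gamma>))" for i
  proof (cases "fmlookup \<theta> i")
    case (Some u)
    then have "u \<in> fmran' \<theta>" by (rule fmran'I)
    moreover have "fv u \<subseteq> fv (Case \<theta> t)" using Some by (auto intro!: bexI fmran'I)
    ultimately have "interp n M u \<Gamma> = arr (length \<Gamma>) (Suc 0) (\<lambda>_. nrename (case_nf n u) (level \<Gamma>))"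
      using Case.IH(1)[of u \<Gamma>] Case.prems by (meson order_trans)
    with Some show ?thesis by (simp add: g_def)
  qed (simp add: g_def)
  then have "Tuple M (Power M (D M) (length \<Gamma>)) ?f n =
      arr (length \<Gamma>) n (\<lambda>i. nrename (g (n - 1 - i)) (level \<Gamma>))"
    by (simp add: Tuple_arr)
  moreover have "interp n M t \<Gamma> = arr (length \<Gamma>) (Suc 0) (\<lambda>_. nrename (case_nf n t) (level \<Gamma>))"
    using Case.IH(2)[of \<Gamma>] Case.prems by simp
  moreover have "case_nf n (Case \<theta> t) = push (case_nf n t) (map g [0..<n])"
    by (simp add: g_def[abs_def])
  ultimately show ?case
    by (auto simp: nfv_cas_body nsubst_cas_body nrename_push comp_def list_all2_conv_all_nth simp del: case_nf.simps
        intro!: arr_cong nconv_push)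
qed

end

section \<open>Reduction to case-normal form\<close>

lemma nrename_eq_NFail [simp]: "nrename u r = NFail \<longleftrightarrow> u = NFail"
  by (cases u) auto

text \<open>The failure test reads \<open>\<phi>\<close> while the terms come separately in
  \<open>us\<close>, so that \<open>trm_of\<close> is primitive recursive.\<close>

definition branches :: "nform list \<Rightarrow> trm list \<Rightarrow> (nat, trm) fmap" where
  "branches \<phi> us = fmfilter (\<lambda>c. \<phi> ! c \<noteq> NFail) (fmap_of_list (zip [0..<length us] us))"

text \<open>The value at \<open>NFail\<close> is irrelevant: failing branches are deleted.\<close>

primrec trm_of :: "nform \<Rightarrow> trm" where
  "trm_of (NVar i) = Var i"
| "trm_of (NCon c) = Con c"
| "trm_of NFail = Case fmempty (Con 0)"
| "trm_of (NApp t u) = App (trm_of t) (trm_of u)"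
| "trm_of (NLam t) = Lam (trm_of t)"
| "trm_of (NCase \<phi> x) = Case (branches \<phi> (map trm_of \<phi>)) (Var x)"

abbreviation binding_of :: "nform list \<Rightarrow> (nat, trm) fmap" where
  "binding_of \<phi> \<equiv> branches \<phi> (map trm_of \<phi>)"

lemma fmlookup_branches [simp]:
  "fmlookup (branches \<phi> us) c = (if c < length us \<and> \<phi> ! c \<noteq> NFail then Some (us ! c) else None)"
proof (cases "c < length us")
  case True
  then show ?thesis
    using map_of_zip_nth[of "[0..<length us]" us c] by (simp add: branches_def fmlookup_of_list)
next
  case False
  then have "map_of (zip [0..<length us] us) c = None"
    by (simp add: map_of_zip_is_None)
  with False show ?thesis by (simp add: branches_def fmlookup_of_list)
qed

section \<open>The two translations, renaming and substitution\<close>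

lemma trm_of_nrename: "trm_of (nrename t r) = rename (trm_of t) r"
proof (induction t arbitrary: r)
  case (NCase \<phi> x)
  then show ?case by (auto intro!: fmap_ext)
qed auto

lemma binding_of_nlift: "binding_of (map nlift \<phi>) = fmmap lift (binding_of \<phi>)"
  by (rule fmap_ext) (simp add: trm_of_nrename)

lemma case_nf_rename: "case_nf n (rename t r) = nrename (case_nf n t) r"
proof (induction t arbitrary: r)
  case (Case \<theta> t)
  have "(case fmlookup (fmmap (case_nf n) (fmmap (\<lambda>u. rename u r) \<theta>)) c of Some u \<Rightarrow> u | None \<Rightarrow> NFail) =
      nrename (case fmlookup (fmmap (case_nf n) \<theta>) c of Some u \<Rightarrow> u | None \<Rightarrow> NFail) r" for c
    using Case.IH(1) by (auto split: option.split intro: fmran'I)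
  then show ?case by (simp add: nrename_push Case.IH(2) comp_def del: fmlookup_map)
qed auto

text \<open>An equation, since \<open>nsubst\<close> pushes the cases that substitution unblocks. It
  identifies the normal form of a contracted beta-redex.\<close>

lemma case_nf_subst: "case_nf n (subst t s) = nsubst (case_nf n t) (\<lambda>i. case_nf n (s i))"
proof (induction t arbitrary: s)
  case (Lam t)
  have "(\<lambda>i. case_nf n (case_nat (Var 0) (\<lambda>i. lift (s i)) i)) =
      case_nat (NVar 0) (\<lambda>i. nlift (case_nf n (s i)))"
    by (auto split: nat.split simp: case_nf_rename)
  with Lam show ?case by simp
next
  case (Case \<theta> t)
  have "(case fmlookup (fmmap (case_nf n) (fmmap (\<lambda>u. subst u s) \<theta>)) c of Some u \<Rightarrow> u | None \<Rightarrow> NFail) =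
      nsubst (case fmlookup (fmmap (case_nf n) \<theta>) c of Some u \<Rightarrow> u | None \<Rightarrow> NFail)
        (\<lambda>i. case_nf n (s i))" for c
    using Case.IH(1) by (auto split: option.split intro: fmran'I)
  then show ?case by (simp add: nsubst_push Case.IH(2) comp_def del: fmlookup_map)
qed auto

text \<open>The case-normal forms in which \<open>NFail\<close> only marks the missing branches of a case-binding.\<close>

inductive proper :: "nat \<Rightarrow> nform \<Rightarrow> bool" for n where
  "proper n (NVar i)"
| "proper n (NCon c)"
| "proper n t \<Longrightarrow> proper n u \<Longrightarrow> proper n (NApp t u)"
| "proper n t \<Longrightarrow> proper n (NLam t)"
| "length \<phi> = n \<Longrightarrow> (\<And>u. u \<in> set \<phi> \<Longrightarrow> u \<noteq> NFail \<Longrightarrow> proper n u) \<Longrightarrow> proper n (NCase \<phi> x)"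

inductive_simps proper_simps [simp]:
  "proper n (NVar i)"
  "proper n (NCon c)"
  "proper n NFail"
  "proper n (NApp t u)"
  "proper n (NLam t)"
  "proper n (NCase \<phi> x)"

lemma proper_nrename [simp]: "proper n (nrename t r) \<longleftrightarrow> proper n t"
  by (induction t arbitrary: r) auto

text \<open>Filling up with \<open>NFail\<close> restores the branches deleted by
  \<open>trm_of\<close>, as failure occurs nowhere else.\<close>

lemma case_nf_trm_of: "proper n t \<Longrightarrow> case_nf n (trm_of t) = t"
proof (induction rule: proper.induct)
  case (5 \<phi> x)
  then show ?case by (auto intro!: nth_equalityI)
qed auto

\<comment> \<open>Reduction stays within the given constructors\<close>
inductive_simps is_term_simps [simp]:
  "is_term n (Var i)"
  "is_term n (App t u)"
  "is_term n (Lam t)"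
  "is_term n (Con c)"
  "is_term n (Case \<theta> t)"

lemma is_term_rename [simp]: "is_term n (rename t r) \<longleftrightarrow> is_term n t"
proof (induction t arbitrary: r)
  case (Case \<theta> t)
  have "is_term n (rename u r) \<longleftrightarrow> is_term n u" if "fmlookup \<theta> c = Some u" for c u
    using Case.IH(1) that by (blast intro: fmran'I)
  then show ?case by (simp add: Case.IH(2)) metis
qed auto

lemma is_term_subst: "is_term n t \<Longrightarrow> (\<And>i. is_term n (s i)) \<Longrightarrow> is_term n (subst t s)"
proof (induction arbitrary: s rule: is_term.induct)
  case (3 t)
  have "is_term n (subst t (case_nat (Var 0) (\<lambda>i. lift (s i))))"
    by (rule 3(2)) (simp add: 3 split: nat.split)
  then show ?case by simp
next
  case (5 \<theta> t)
  then show ?case by auto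
qed auto

lemma step_is_term: "step t u \<Longrightarrow> is_term n t \<Longrightarrow> is_term n u"
proof (induction rule: step.induct)
  case (AppLam t u)
  then show ?case unfolding inst_def by (intro is_term_subst) (auto split: nat.split)
qed (auto simp: case_comp_def split: if_splits)

lemma steps_is_term: "step\<^sup>*\<^sup>* t u \<Longrightarrow> is_term n t \<Longrightarrow> is_term n u"
  by (induction rule: rtranclp_induct) (auto intro: step_is_term)

section \<open>Congruence of many-step reduction\<close>

lemma steps_map:
  assumes "step\<^sup>*\<^sup>* t u" "\<And>a b. step a b \<Longrightarrow> step (f a) (f b)"
  shows "step\<^sup>*\<^sup>* (f t) (f u)"
  using assms(1) by (induction rule: rtranclp_induct) (auto intro: assms(2) rtranclp.rtrancl_into_rtrancl)

lemma steps_App: "step\<^sup>*\<^sup>* t t' \<Longrightarrow> step\<^sup>*\<^sup>* u u' \<Longrightarrow> step\<^sup>*\<^sup>* (App t u) (App t' u')"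
  using steps_map[of t t' "\<lambda>a. App a u", OF _ AppL] steps_map[of u u' "App t'", OF _ AppR]
  by (blast intro: rtranclp_trans)

lemma steps_Lam: "step\<^sup>*\<^sup>* t t' \<Longrightarrow> step\<^sup>*\<^sup>* (Lam t) (Lam t')"
  by (rule steps_map) (auto intro: step.intros)

lemma steps_Case_arg: "step\<^sup>*\<^sup>* t t' \<Longrightarrow> step\<^sup>*\<^sup>* (Case \<theta> t) (Case \<theta> t')"
  by (rule steps_map) (auto intro: step.intros)

lemma steps_Case_branch:
  assumes "step\<^sup>*\<^sup>* u u'" "fmlookup \<theta> c = Some u"
  shows "step\<^sup>*\<^sup>* (Case \<theta> t) (Case (fmupd c u' \<theta>) t)"
  using assms(1)
proof (induction rule: rtranclp_induct)
  case base
  have "fmupd c u \<theta> = \<theta>" using assms(2) by (intro fmap_ext) auto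
  then show ?case by simp
next
  case (step y z)
  have "fmupd c z (fmupd c y \<theta>) = fmupd c z \<theta>" by (intro fmap_ext) auto
  with step(2) have "step (Case (fmupd c y \<theta>) t) (Case (fmupd c z \<theta>) t)"
    using CaseBranch[of "fmupd c y \<theta>" c y z t] by simp
  with step(3) show ?case by (rule rtranclp.rtrancl_into_rtrancl)
qed

lemma steps_Case_branches:
  assumes dom: "fmdom \<theta> = fmdom \<theta>'"
    and steps: "\<And>c u u'. fmlookup \<theta> c = Some u \<Longrightarrow> fmlookup \<theta>' c = Some u' \<Longrightarrow> step\<^sup>*\<^sup>* u u'"
  shows "step\<^sup>*\<^sup>* (Case \<theta> t) (Case \<theta>' t)"
proof -
  \<comment> \<open>\<open>S\<close> collects the constructors whose branches are already those of
    \<open>\<theta>'\<close>; finiteness of the domain completes the replacement.\<close>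
  have *: "step\<^sup>*\<^sup>* (Case \<theta> t) (Case (fmadd \<theta> (fmrestrict_set S \<theta>')) t)"
    if "finite S" "S \<subseteq> fset (fmdom \<theta>')" for S
    using that
  proof (induction rule: finite_induct)
    case empty
    have "fmadd \<theta> (fmrestrict_set {} \<theta>') = \<theta>" by (rule fmap_ext) auto
    then show ?case by simp
  next
    case (insert c S)
    let ?\<theta> = "fmadd \<theta> (fmrestrict_set S \<theta>')"
    obtain u' where u': "fmlookup \<theta>' c = Some u'" using insert.prems fmdomE[of c \<theta>'] by auto
    moreover obtain u where u: "fmlookup \<theta> c = Some u"
      using insert.prems fmdomE[of c \<theta>] dom by auto
    ultimately have "step\<^sup>*\<^sup>* u u'" by (intro steps)
    moreover have "fmlookup ?\<theta> c = Some u"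
      using u insert.hyps by (simp add: fmlookup_dom_iff)
    ultimately have s: "step\<^sup>*\<^sup>* (Case ?\<theta> t) (Case (fmupd c u' ?\<theta>) t)"
      by (rule steps_Case_branch)
    have "fmupd c u' ?\<theta> = fmadd \<theta> (fmrestrict_set (insert c S) \<theta>')"
      using u' by (intro fmap_ext) (auto simp: fmlookup_dom_iff)
    with s have "step\<^sup>*\<^sup>* (Case ?\<theta> t) (Case (fmadd \<theta> (fmrestrict_set (insert c S) \<theta>')) t)"
      by simp
    moreover have "step\<^sup>*\<^sup>* (Case \<theta> t) (Case ?\<theta> t)"
      using insert.prems by (intro insert.IH) simp
    ultimately show ?case by (rule rtranclp_trans[rotated])
  qed
  have "fmadd \<theta> (fmrestrict_set (fset (fmdom \<theta>')) \<theta>') = \<theta>'"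
  proof (rule fmap_ext)
    fix c
    show "fmlookup (fmadd \<theta> (fmrestrict_set (fset (fmdom \<theta>')) \<theta>')) c = fmlookup \<theta>' c"
    proof (cases "fmlookup \<theta>' c")
      case None
      then have "fmlookup \<theta> c = None" using dom by (metis fmdom_notD fmdom_notI)
      with None show ?thesis by simp
    next
      case (Some u)
      then show ?thesis by (simp add: fmlookup_dom_iff)
    qed
  qed
  with *[of "fset (fmdom \<theta>')"] show ?thesis by simp
qed

section \<open>Hereditary definedness of reducts and subterms\<close>

lemma hereditarily_defined_steps:
  "hereditarily_defined t \<Longrightarrow> step\<^sup>*\<^sup>* t u \<Longrightarrow> hereditarily_defined u"
  unfolding hereditarily_defined_def by (meson rtranclp_trans)

text \<open>A reduct of a part extends to a reduct of the whole by congruence, and a match failure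
  in the part is one in the whole. The other term formers are treated alike.\<close>

lemma hereditarily_defined_App:
  assumes "hereditarily_defined (App t u)"
  shows "hereditarily_defined t" "hereditarily_defined u"
proof -
  show "hereditarily_defined t"
    unfolding hereditarily_defined_def
  proof (intro allI impI)
    fix v assume "step\<^sup>*\<^sup>* t v"
    then have "defined (App v u)"
      using assms by (auto simp: hereditarily_defined_def intro: steps_App)
    then show "defined v" by (auto simp: defined_def intro: subterm.intros(2))
  qed
  show "hereditarily_defined u"
    unfolding hereditarily_defined_def
  proof (intro allI impI)
    fix v assume "step\<^sup>*\<^sup>* u v"
    then have "defined (App t v)"
      using assms by (auto simp: hereditarily_defined_def intro: steps_App)
    then show "defined v" by (auto simp: defined_def intro: subterm.intros(3))
  qed
qed

lemma hereditarily_defined_Lam: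
  assumes "hereditarily_defined (Lam t)"
  shows "hereditarily_defined t"
  unfolding hereditarily_defined_def
proof (intro allI impI)
  fix v assume "step\<^sup>*\<^sup>* t v"
  then have "defined (Lam v)"
    using assms by (auto simp: hereditarily_defined_def intro: steps_Lam)
  then show "defined v" by (auto simp: defined_def intro: subterm.intros(4))
qed

lemma hereditarily_defined_Case_arg:
  assumes "hereditarily_defined (Case \<theta> t)"
  shows "hereditarily_defined t"
  unfolding hereditarily_defined_def
proof (intro allI impI)
  fix v assume "step\<^sup>*\<^sup>* t v"
  then have "defined (Case \<theta> v)"
    using assms by (auto simp: hereditarily_defined_def intro: steps_Case_arg)
  then show "defined v" by (auto simp: defined_def intro: subterm.intros(5))
qed

lemma hereditarily_defined_Case_branch:
  assumes "hereditarily_defined (Case \<theta> t)" "fmlookup \<theta> c = Some u"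
  shows "hereditarily_defined u"
  unfolding hereditarily_defined_def
proof (intro allI impI)
  fix v assume "step\<^sup>*\<^sup>* u v"
  then have "defined (Case (fmupd c v \<theta>) t)"
    using assms by (auto simp: hereditarily_defined_def intro: steps_Case_branch)
  moreover have "subterm s (Case (fmupd c v \<theta>) t)" if "subterm s v" for s
    using that by (intro subterm.intros(6)[of _ c v]) auto
  ultimately show "defined v" by (auto simp: defined_def)
qed

lemma hereditarily_defined_Case_Con:
  assumes "hereditarily_defined (Case \<theta> (Con c))"
  obtains u where "fmlookup \<theta> c = Some u"
proof -
  have "\<not> match_failure (Case \<theta> (Con c))"
    using assms by (auto simp: hereditarily_defined_def defined_def intro: subterm.intros(1))
  then show thesis using that by (auto simp: match_failure_def elim: fmdomE)
qed

section \<open>Simulating normal forms by reduction of terms\<close>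

text \<open>Each clause of \<open>push\<close> is one reduction rule, except the failing ones, which
  hereditary definedness excludes.\<close>

lemma steps_push:
  assumes "proper n t" "length \<theta> = n" "\<And>u. u \<in> set \<theta> \<Longrightarrow> u \<noteq> NFail \<Longrightarrow> proper n u"
    and "hereditarily_defined (Case (binding_of \<theta>) (trm_of t))"
  shows "proper n (push t \<theta>) \<and> step\<^sup>*\<^sup>* (Case (binding_of \<theta>) (trm_of t)) (trm_of (push t \<theta>))"
  using assms
proof (induction arbitrary: \<theta> rule: proper.induct)
  case (1 i)
  then show ?case by auto
next
  case (2 c)
  \<comment> \<open>Otherwise the case on \<open>Con c\<close> would be a match failure.\<close>
  from 2(3) have "c < n" "\<theta> ! c \<noteq> NFail"
    using 2(1) by (auto elim!: hereditarily_defined_Case_Con split: if_splits)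
  moreover from this have "step (Case (binding_of \<theta>) (Con c)) (trm_of (\<theta> ! c))"
    using 2(1) by (intro CaseCons) auto
  ultimately show ?case using 2 by auto
next
  case (3 t u)
  let ?v = "App (Case (binding_of \<theta>) (trm_of t)) (trm_of u)"
  have s: "step (Case (binding_of \<theta>) (trm_of (NApp t u))) ?v" by (simp add: CaseApp)
  then have "hereditarily_defined ?v" using 3(7) hereditarily_defined_steps by blast
  then have "proper n (push t \<theta>) \<and> step\<^sup>*\<^sup>* (Case (binding_of \<theta>) (trm_of t)) (trm_of (push t \<theta>))"
    using 3 hereditarily_defined_App by blast
  then show ?case
    using s 3(2) by (auto intro: converse_rtranclp_into_rtranclp steps_App)
next
  case (4 t)
  let ?v = "Lam (Case (binding_of (map nlift \<theta>)) (trm_of t))"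
  have s: "step (Case (binding_of \<theta>) (trm_of (NLam t))) ?v"
    unfolding binding_of_nlift by (simp add: CaseLam)
  then have "hereditarily_defined ?v" using 4(5) hereditarily_defined_steps by blast
  then have "hereditarily_defined (Case (binding_of (map nlift \<theta>)) (trm_of t))"
    by (rule hereditarily_defined_Lam)
  then have "proper n (push t (map nlift \<theta>)) \<and>
      step\<^sup>*\<^sup>* (Case (binding_of (map nlift \<theta>)) (trm_of t)) (trm_of (push t (map nlift \<theta>)))"
    using 4(3,4) by (intro 4(2)) auto
  then show ?case
    using s by (auto intro: converse_rtranclp_into_rtranclp steps_Lam)
next
  case (5 \<phi> x)
  let ?\<psi> = "case_comp (binding_of \<theta>) (binding_of \<phi>)"
  have s: "step (Case (binding_of \<theta>) (trm_of (NCase \<phi> x))) (Case ?\<psi> (Var x))"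
    by (simp add: CaseCase)
  then have hd: "hereditarily_defined (Case ?\<psi> (Var x))"
    using 5(6) hereditarily_defined_steps by blast
  have *: "proper n (push u \<theta>) \<and> step\<^sup>*\<^sup>* (Case (binding_of \<theta>) (trm_of u)) (trm_of (push u \<theta>))"
    if u: "u \<in> set \<phi>" "u \<noteq> NFail" for u
  proof -
    obtain c where "c < length \<phi>" "\<phi> ! c = u" using u by (auto simp: in_set_conv_nth)
    with u have "fmlookup ?\<psi> c = Some (Case (binding_of \<theta>) (trm_of u))"
      by (simp add: case_comp_def)
    with hd have "hereditarily_defined (Case (binding_of \<theta>) (trm_of u))"
      by (rule hereditarily_defined_Case_branch)
    with 5 u show ?thesis by blast
  qed
  \<comment> \<open>The pushed branch is proper and hence not \<open>NFail\<close>; so exactly the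
    same branches are missing before and after, and the domains agree.\<close>
  have eq: "push u \<theta> = NFail \<longleftrightarrow> u = NFail" if "u \<in> set \<phi>" for u
    using *[OF that] by (cases "u = NFail") auto
  have "step\<^sup>*\<^sup>* (Case ?\<psi> (Var x)) (Case (binding_of (map (\<lambda>u. push u \<theta>) \<phi>)) (Var x))"
  proof (rule steps_Case_branches)
    show "fmdom ?\<psi> = fmdom (binding_of (map (\<lambda>u. push u \<theta>) \<phi>))"
      by (intro fset_eqI) (auto simp: fmlookup_dom_iff case_comp_def eq)
  qed (auto simp: case_comp_def eq * split: if_splits)
  moreover have "proper n (push u \<theta>)" if "u \<in> set \<phi>" "push u \<theta> \<noteq> NFail" for u
    using *[of u] eq[of u] that by blast
  ultimately show ?case
    using s 5(1) by (auto intro: converse_rtranclp_into_rtranclp)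
qed

lemma steps_case_nf:
  assumes "is_term n t" "hereditarily_defined t"
  shows "proper n (case_nf n t) \<and> step\<^sup>*\<^sup>* t (trm_of (case_nf n t))"
  using assms
proof (induction rule: is_term.induct)
  case (2 t u)
  then show ?case using hereditarily_defined_App[OF 2(5)] by (auto intro: steps_App)
next
  case (3 t)
  then show ?case using hereditarily_defined_Lam[OF 3(3)] by (auto intro: steps_Lam)
next
  case (5 \<theta> t)
  define \<Theta> where
    "\<Theta> = map (\<lambda>c. case fmlookup (fmmap (case_nf n) \<theta>) c of Some u \<Rightarrow> u | None \<Rightarrow> NFail) [0..<n]"
  have branch: "c < n \<and> proper n (case_nf n u) \<and> step\<^sup>*\<^sup>* u (trm_of (case_nf n u))"
    if "fmlookup \<theta> c = Some u" for c u
    using 5(1)[OF that] hereditarily_defined_Case_branch[OF 5(4) that] by blast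
  \<comment> \<open>So filling up the binding with \<open>NFail\<close> and deleting the failing
    branches leaves its domain unchanged.\<close>
  then have nofail: "case_nf n u \<noteq> NFail" if "fmlookup \<theta> c = Some u" for c u
    using that by fastforce
  have arg: "proper n (case_nf n t) \<and> step\<^sup>*\<^sup>* t (trm_of (case_nf n t))"
    using 5(2) hereditarily_defined_Case_arg[OF 5(4)] by blast
  have "step\<^sup>*\<^sup>* (Case \<theta> t) (Case (binding_of \<Theta>) t)"
  proof (rule steps_Case_branches)
    show "fmdom \<theta> = fmdom (binding_of \<Theta>)"
      using branch nofail
      by (intro fset_eqI) (fastforce simp: fmlookup_dom_iff \<Theta>_def split: option.splits if_splits)
  qed (use branch nofail in \<open>auto simp: \<Theta>_def split: if_splits\<close>)
  also have "step\<^sup>*\<^sup>* (Case (binding_of \<Theta>) t) (Case (binding_of \<Theta>) (trm_of (case_nf n t)))"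
    using arg by (intro steps_Case_arg) simp
  finally have s: "step\<^sup>*\<^sup>* (Case \<theta> t) (Case (binding_of \<Theta>) (trm_of (case_nf n t)))" .
  have "proper n (push (case_nf n t) \<Theta>) \<and>
      step\<^sup>*\<^sup>* (Case (binding_of \<Theta>) (trm_of (case_nf n t))) (trm_of (push (case_nf n t) \<Theta>))"
  proof (rule steps_push)
    show "hereditarily_defined (Case (binding_of \<Theta>) (trm_of (case_nf n t)))"
      using 5(4) s by (rule hereditarily_defined_steps)
    show "proper n u" if "u \<in> set \<Theta>" "u \<noteq> NFail" for u
      using that branch by (auto simp: \<Theta>_def split: option.splits)
  qed (use arg in \<open>simp_all add: \<Theta>_def\<close>)
  moreover have "case_nf n (Case \<theta> t) = push (case_nf n t) \<Theta>" by (simp add: \<Theta>_def)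
  ultimately show ?case using s by (auto intro: rtranclp_trans)
qed auto

text \<open>Beta and eta are rules of the calculus, and hereditary definedness keeps the reducts
  proper.\<close>

lemma steps_of_par:
  assumes "par t u" "proper n t" "is_term n (trm_of t)" "hereditarily_defined (trm_of t)"
  shows "proper n u \<and> step\<^sup>*\<^sup>* (trm_of t) (trm_of u)"
  using assms
proof (induction rule: par.induct)
  case (par_NApp t t' u u')
  then show ?case
    using hereditarily_defined_App[of "trm_of t" "trm_of u"] by (auto intro: steps_App)
next
  case (par_NLam t t')
  then show ?case
    using hereditarily_defined_Lam[of "trm_of t"] by (auto intro: steps_Lam)
next
  case (par_NCase \<phi> \<phi>' x)
  have len: "length \<phi>' = length \<phi>" using par_NCase(1) by (auto dest: list_all2_lengthD)
  have branch: "proper n (\<phi>' ! c) \<and> step\<^sup>*\<^sup>* (trm_of (\<phi> ! c)) (trm_of (\<phi>' ! c))"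
    if "c < length \<phi>" "\<phi> ! c \<noteq> NFail" for c
  proof -
    have l: "fmlookup (binding_of \<phi>) c = Some (trm_of (\<phi> ! c))" using that by simp
    have "proper n (\<phi> ! c)" using par_NCase.prems(1) that by simp
    moreover have "is_term n (trm_of (\<phi> ! c))"
      using par_NCase.prems(2) l by (simp only: trm_of.simps is_term_simps)
    moreover have "hereditarily_defined (trm_of (\<phi> ! c))"
      using par_NCase.prems(3) l by (auto intro: hereditarily_defined_Case_branch)
    ultimately show ?thesis
      using par_NCase(1) that by (auto simp: list_all2_conv_all_nth)
  qed
  have eq: "\<phi>' ! c = NFail \<longleftrightarrow> \<phi> ! c = NFail" if "c < length \<phi>" for c
  proof (cases "\<phi> ! c = NFail")
    case True
    moreover have "par (\<phi> ! c) (\<phi>' ! c)"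
      using par_NCase(1) that by (auto simp: list_all2_conv_all_nth)
    ultimately show ?thesis by (auto elim: par_NFailE)
  next
    case False
    with branch[OF that] show ?thesis by auto
  qed
  have "step\<^sup>*\<^sup>* (Case (binding_of \<phi>) (Var x)) (Case (binding_of \<phi>') (Var x))"
  proof (rule steps_Case_branches)
    show "fmdom (binding_of \<phi>) = fmdom (binding_of \<phi>')"
      by (intro fset_eqI) (auto simp: fmlookup_dom_iff len eq)
  qed (auto simp: len branch split: if_splits)
  moreover have "proper n (NCase \<phi>' x)"
    using par_NCase.prems(1) branch eq len by (auto simp: in_set_conv_nth)
  ultimately show ?case by simp
next
  case (par_beta t t' u u')
  have hd: "hereditarily_defined (trm_of t)" "hereditarily_defined (trm_of u)"
    using par_beta.prems(3) by (auto dest: hereditarily_defined_App hereditarily_defined_Lam)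
  have t: "proper n t'" "step\<^sup>*\<^sup>* (trm_of t) (trm_of t')"
    and u: "proper n u'" "step\<^sup>*\<^sup>* (trm_of u) (trm_of u')"
    using par_beta.IH par_beta.prems hd by auto
  let ?v = "inst (trm_of t') (trm_of u')"
  have "step\<^sup>*\<^sup>* (trm_of (NApp (NLam t) u)) (App (Lam (trm_of t')) (trm_of u'))"
    using t u by (auto intro: steps_App steps_Lam)
  also have "step \<dots> ?v" by (rule AppLam)
  finally have s: "step\<^sup>*\<^sup>* (trm_of (NApp (NLam t) u)) ?v" .
  \<comment> \<open>Contracting beta in the term may leave unstuck cases, so the result is brought
    to case-normal form again, which is \<open>ninst t' u'\<close>.\<close>
  have "proper n (case_nf n ?v) \<and> step\<^sup>*\<^sup>* ?v (trm_of (case_nf n ?v))"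
    using par_beta.prems s
    by (intro steps_case_nf) (blast intro: steps_is_term hereditarily_defined_steps)+
  moreover have "case_nf n ?v = ninst t' u'"
    unfolding inst_def case_nf_subst using t u
    by (auto simp: case_nf_trm_of intro!: arg_cong[where f = "nsubst t'"] split: nat.split)
  ultimately show ?case using s by (auto intro: rtranclp_trans)
next
  case (par_eta t t')
  have s: "step (trm_of (NLam (NApp (nlift t) (NVar 0)))) (trm_of t)"
    by (simp add: trm_of_nrename LamApp)
  then have "proper n t' \<and> step\<^sup>*\<^sup>* (trm_of t) (trm_of t')"
    using par_eta.prems by (intro par_eta.IH) (auto intro: step_is_term hereditarily_defined_steps)
  with s show ?case by (auto intro: converse_rtranclp_into_rtranclp)
qed auto

lemma steps_of_pars:
  assumes "par\<^sup>*\<^sup>* t u" "proper n t" "is_term n (trm_of t)" "hereditarily_defined (trm_of t)"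
  shows "proper n u \<and> step\<^sup>*\<^sup>* (trm_of t) (trm_of u)"
  using assms(1)
proof (induction rule: rtranclp_induct)
  case (step u v)
  then have "is_term n (trm_of u)" "hereditarily_defined (trm_of u)"
    using assms(3,4) steps_is_term hereditarily_defined_steps by blast+
  with step steps_of_par[of u v n] show ?case by auto
qed (simp add: assms)

lemma conv_of_steps:
  assumes "step\<^sup>*\<^sup>* t u" "is_term n t"
  shows "conv n t u"
  using assms(1)
proof (induction rule: rtranclp_induct)
  case (step u v)
  then have "is_term n u" "is_term n v"
    using assms(2) steps_is_term step_is_term by blast+
  with step show ?case unfolding conv_def by (auto intro: equivclp_into_equivclp)
qed (simp add: conv_def)

text \<open>Both terms reduce to \<open>trm_of v\<close> for a common reduct \<open>v\<close> of
  their normal forms, through case-normal form and then by simulated beta-eta steps.\<close>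

lemma conv_of_nconv:
  assumes "is_term n t" "is_term n t'" "hereditarily_defined t" "hereditarily_defined t'"
    and "case_nf n t \<approx> case_nf n t'"
  shows "conv n t t'"
proof -
  obtain v where v: "par\<^sup>*\<^sup>* (case_nf n t) v" "par\<^sup>*\<^sup>* (case_nf n t') v"
    using assms(5) by (rule nconv_imp_joinable)
  have "step\<^sup>*\<^sup>* u (trm_of v)"
    if u: "is_term n u" "hereditarily_defined u" and "par\<^sup>*\<^sup>* (case_nf n u) v" for u
  proof -
    note nf = steps_case_nf[OF u]
    then have "is_term n (trm_of (case_nf n u))" "hereditarily_defined (trm_of (case_nf n u))"
      using u by (blast intro: steps_is_term hereditarily_defined_steps)+
    with steps_of_pars[OF that(3)] nf have "step\<^sup>*\<^sup>* (trm_of (case_nf n u)) (trm_of v)" by blast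
    with nf show ?thesis by (auto intro: rtranclp_trans)
  qed
  with assms v have "conv n t (trm_of v)" "conv n t' (trm_of v)"
    by (blast intro: conv_of_steps)+
  then show ?thesis unfolding conv_def by (meson equivclp_sym equivclp_trans)
qed

theorem theorem2:
  fixes n :: nat and t t' :: trm and \<Gamma> :: "nat list"
  assumes "infinite (UNIV :: 'o set)" and "infinite (UNIV :: 'm set)"
    and "is_term n t" and "is_term n t'"
    and "hereditarily_defined t" and "hereditarily_defined t'"
    and "distinct \<Gamma>" and "fv t \<union> fv t' \<subseteq> set \<Gamma>"
    and "\<And>M :: ('o, 'm) lc_model. lc_model n M \<Longrightarrow> interp n M t \<Gamma> = interp n M t' \<Gamma>"
  shows "conv n t t'"
proof (rule conv_of_nconv[OF assms(3-6)])
  obtain eo :: "nat \<Rightarrow> 'o" where eo: "inj eo"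
    using infinite_countable_subset[OF assms(1)] by blast
  obtain g :: "nat \<Rightarrow> 'm" where "inj g"
    using infinite_countable_subset[OF assms(2)] by blast
  then have em: "inj (g \<circ> (to_nat :: nat \<times> nat \<times> nform list \<Rightarrow> nat))"
    by (simp add: inj_compose)
  interpret term_model eo "g \<circ> to_nat" n
    using eo em by unfold_locales
  \<comment> \<open>Inverts \<open>level \<Gamma>\<close> on the names in \<Gamma>, so the renaming
    to levels can be undone after comparing in the model.\<close>
  let ?\<rho> = "\<lambda>j. \<Gamma> ! (length \<Gamma> - Suc j)"
  have inv: "nrename (nrename (case_nf n u) (level \<Gamma>)) ?\<rho> = case_nf n u" if "fv u \<subseteq> set \<Gamma>" for u
    unfolding nrename_nrename
  proof (rule nrename_ident)
    fix i assume "i \<in> nfv (case_nf n u)"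
    with that nfv_case_nf[of n u] have "i \<in> set \<Gamma>" by blast
    then obtain j where "j < length \<Gamma>" "\<Gamma> ! j = i" by (auto simp: in_set_conv_nth)
    with assms(7) show "(?\<rho> \<circ> level \<Gamma>) i = i" by (auto simp: level_def position_nth)
  qed
  have "interp n M t \<Gamma> = interp n M t' \<Gamma>" by (rule assms(9)) (rule lc_model_M)
  then have "nrename (case_nf n t) (level \<Gamma>) \<approx> nrename (case_nf n t') (level \<Gamma>)"
    using assms(7,8) by (simp add: interp_eq arr_eq_iff)
  from nconv_nrename[OF this, of ?\<rho>] show "case_nf n t \<approx> case_nf n t'"
    using assms(8) by (simp add: inv)
qed

end
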